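(* Let $\varepsilon>0$ and let $\Omega$ be a causally convex domain in $\mathbf{R}^{1,n}$ that is neither future nor past complete. Let $\tau^-$ and $\tau^+$ be the associated past and future cosmological time functions. If $\partial_c^+\Omega$ and $\partial_c^-\Omega$ are $\varepsilon$-stably acausal, then $$\frac{\varepsilon}{2\sqrt{2+2(1+\varepsilon)^2}}\,\hat d_{\ln(\tau^-/\tau^+)}-c_\varepsilon\le\delta_\Omega\le 2\,\hat d_{\ln(\tau^-/\tau^+)},$$ where $c_\varepsilon=\frac{\varepsilon}{\sqrt{2+2(1+\varepsilon)^2}}\ln\left(\frac{(1+\varepsilon)^2+1}{(1+\varepsilon)^2-1}\right)$.
   Context: Minkowski space: $\mathbf{R}^{1,n}$ ($n\ge 1$) is $\mathbf{R}\times\mathbf{R}^n$ with coordinates $(t,p)$, flat metric $\mathbf{b}=-dt^2+dp_1^2+\dots+dp_n^2$ and time orientation $\partial_t$. A nonzero vector $v$ is lightlike if $\mathbf{b}(v,v)=0$, causal if $\mathbf{b}(v,v)\le 0$; a causal vector is future if $\mathbf{b}(v,\partial_t)<0$ and past otherwise; a future (past) causal curve is a piecewise smooth curve with future (past) causal velocity. Write $x\le y$ if $x=y$ or there is a future causal curve from $x$ to $y$; $J^+(x)=\{y:x\le y\}$, $J^-(x)=\{y:y\le x\}$. A domain is a nonempty, connected, proper open subset of $\mathbf{R}^{1,n}$. A domain $\Omega$ is causally convex if every causal curve of $\mathbf{R}^{1,n}$ with endpoints in $\Omega$ is contained in $\Omega$, and future (past) complete if every future (past) causal curve of $\mathbf{R}^{1,n}$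 starting in $\Omega$ is contained in $\Omega$. Cosmological times: for $x\le y$ let $\mathcal{T}(x,y)=\mathcal{T}(y,x)=\sqrt{|\mathbf{b}(y-x,y-x)|}$; $\tau^\pm(x)=\sup\{\mathcal{T}(x,y): y\in\Omega\cap J^\pm(x)\}$. Null distance: for a time function $T:\Omega\to\mathbf{R}$ (continuous and strictly increasing along future causal curves), $\hat d_T(x,y)=\inf\sum_{k=1}^{m-1}|T(x_{k+1})-T(x_k)|$, the infimum over all finite sequences $x_1=x,\dots,x_m=y$ in $\Omega$ such that $x_k$ and $x_{k+1}$ are causally related for all $k$. Markowitz pseudodistance: let $I=(-1,1)$ and $\rho_I(s,t)=\left|\ln\frac{(s-1)(t+1)}{(s+1)(t-1)}\right|$. For a domain $\Omega$, a projectively parametrized lightlike geodesic of $\Omega$ is a curve $\gamma:I\to\Omega$, $\gamma(s)=x+h(s)v$, with $v$ lightlike and $h$ a (nonconstant) real homography without pole in $I$. Then $\delta_\Omega(x,y)=\inf\sum_{k=1}^m\rho_I(s_k,t_k)$, the infimum being over all finite families of such geodesics $\gamma_1,\dots,\gamma_m$ and points $s_k,t_k\in I$ with $\gamma_1(s_1)=x$, $\gamma_m(t_m)=y$, $\gamma_k(t_k)=\gamma_{k+1}(s_{k+1})$. Causal boundary: a causally convex domain can be written $\Omega=\{(t,p)\in\mathbf{R}\times U : f_-(p)<t<f_+(p)\}$ with $U\subset\mathbf{R}^n$ open and $f_\pm:\overline U\to\overline{\mathbf{R}}$ 1-Lipschitz, $f_-<f_+$ on $U$, $f_-=f_+$ on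 $\partial U$. $\partial_c^+\Omega$ (resp. $\partial_c^-\Omega$) is the graph $\{(f_\pm(p),p)\}$ of $f_+$ (resp. $f_-$), empty if that function is infinite. Stable acausality: let $\mathbf{b}_\varepsilon=-(1+\varepsilon)^2dt^2+dp_1^2+\dots+dp_n^2$. A subset of $\mathbf{R}^{1,n}$ is $\varepsilon$-stably acausal if no two distinct points of it are causally related for $\mathbf{b}_\varepsilon$. *)

theory Defs
  imports "HOL-Analysis.Analysis"
begin

type_synonym 'n minkowski = "real \<times> (real ^ 'n)"

definition mink :: "'n::finite minkowski \<Rightarrow> 'n minkowski \<Rightarrow> real" where
  "mink v w = - (fst v * fst w) + snd v \<bullet> snd w"

definition mink_eps :: "real \<Rightarrow> 'n::finite minkowski \<Rightarrow> 'n minkowski \<Rightarrow> real" where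
  "mink_eps \<epsilon> v w = - ((1 + \<epsilon>)\<^sup>2 * (fst v * fst w)) + snd v \<bullet> snd w"

definition time_dir :: "'n::finite minkowski" where
  "time_dir = (1, 0)"


text \<open>The causal notions take the flat Lorentzian metric \<open>g\<close> as a parameter, because
  they are needed both for \<open>mink\<close> and for \<open>mink_eps \<epsilon>\<close>.\<close>

definition lightlike :: "('n::finite minkowski \<Rightarrow> 'n minkowski \<Rightarrow> real) \<Rightarrow> 'n minkowski \<Rightarrow> bool" where
  "lightlike g v \<longleftrightarrow> v \<noteq> 0 \<and> g v v = 0"

definition causal :: "('n::finite minkowski \<Rightarrow> 'n minkowski \<Rightarrow> real) \<Rightarrow> 'n minkowski \<Rightarrow> bool" where
  "causal g v \<longleftrightarrow> v \<noteq> 0 \<and> g v v \<le> 0"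

definition future_causal :: "('n::finite minkowski \<Rightarrow> 'n minkowski \<Rightarrow> real) \<Rightarrow> 'n minkowski \<Rightarrow> bool" where
  "future_causal g v \<longleftrightarrow> causal g v \<and> g v time_dir < 0"

definition past_causal :: "('n::finite minkowski \<Rightarrow> 'n minkowski \<Rightarrow> real) \<Rightarrow> 'n minkowski \<Rightarrow> bool" where
  "past_causal g v \<longleftrightarrow> causal g v \<and> \<not> g v time_dir < 0"


text \<open>\<open>D k\<close> is the \<open>k\<close>-th derivative; derivatives are one-sided at end points of \<open>S\<close>.\<close>

definition smooth_curve_on :: "real set \<Rightarrow> (real \<Rightarrow> 'a::real_normed_vector) \<Rightarrow> bool" where
  "smooth_curve_on S \<gamma> \<longleftrightarrow>
     (\<exists>D :: nat \<Rightarrow> real \<Rightarrow> 'a. D 0 = \<gamma> \<and>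
        (\<forall>k. \<forall>s\<in>S. (D k has_vector_derivative D (Suc k) s) (at s within S)))"

text \<open>A piecewise smooth curve on \<open>[a, b]\<close>, \<open>a < b\<close>, whose velocity satisfies \<open>P\<close>; at the
  breakpoints \<open>\<sigma> i\<close> both one-sided velocities have to satisfy \<open>P\<close>.  Continuity is implied,
  since consecutive closed pieces share a point.\<close>

definition piecewise_smooth_curve ::
    "('a::real_normed_vector \<Rightarrow> bool) \<Rightarrow> real \<Rightarrow> real \<Rightarrow> (real \<Rightarrow> 'a) \<Rightarrow> bool" where
  "piecewise_smooth_curve P a b \<gamma> \<longleftrightarrow>
     (\<exists>(m::nat) (\<sigma> :: nat \<Rightarrow> real). m \<ge> 1 \<and> \<sigma> 0 = a \<and> \<sigma> m = b \<and>
        (\<forall>i<m. \<sigma> i < \<sigma> (Suc i) \<and>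
               smooth_curve_on {\<sigma> i..\<sigma> (Suc i)} \<gamma> \<and>
               (\<forall>s\<in>{\<sigma> i..\<sigma> (Suc i)}.
                  P (vector_derivative \<gamma> (at s within {\<sigma> i..\<sigma> (Suc i)})))))"

definition future_causal_curve ::
    "('n::finite minkowski \<Rightarrow> 'n minkowski \<Rightarrow> real) \<Rightarrow> real \<Rightarrow> real \<Rightarrow> (real \<Rightarrow> 'n minkowski) \<Rightarrow> bool" where
  "future_causal_curve g = piecewise_smooth_curve (future_causal g)"

definition past_causal_curve ::
    "('n::finite minkowski \<Rightarrow> 'n minkowski \<Rightarrow> real) \<Rightarrow> real \<Rightarrow> real \<Rightarrow> (real \<Rightarrow> 'n minkowski) \<Rightarrow> bool" where
  "past_causal_curve g = piecewise_smooth_curve (past_causal g)"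

definition causal_le ::
    "('n::finite minkowski \<Rightarrow> 'n minkowski \<Rightarrow> real) \<Rightarrow> 'n minkowski \<Rightarrow> 'n minkowski \<Rightarrow> bool" where
  "causal_le g x y \<longleftrightarrow>
     x = y \<or> (\<exists>a b \<gamma>. future_causal_curve g a b \<gamma> \<and> \<gamma> a = x \<and> \<gamma> b = y)"

definition causally_related ::
    "('n::finite minkowski \<Rightarrow> 'n minkowski \<Rightarrow> real) \<Rightarrow> 'n minkowski \<Rightarrow> 'n minkowski \<Rightarrow> bool" where
  "causally_related g x y \<longleftrightarrow> causal_le g x y \<or> causal_le g y x"

definition J_future :: "'n::finite minkowski \<Rightarrow> 'n minkowski set" where
  "J_future x = {y. causal_le mink x y}"

definition J_past :: "'n::finite minkowski \<Rightarrow> 'n minkowski set" where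
  "J_past x = {y. causal_le mink y x}"


definition minkowski_domain :: "'n::finite minkowski set \<Rightarrow> bool" where
  "minkowski_domain \<Omega> \<longleftrightarrow> \<Omega> \<noteq> {} \<and> connected \<Omega> \<and> \<Omega> \<noteq> UNIV \<and> open \<Omega>"

definition causally_convex :: "'n::finite minkowski set \<Rightarrow> bool" where
  "causally_convex \<Omega> \<longleftrightarrow>
     (\<forall>a b \<gamma>. (future_causal_curve mink a b \<gamma> \<or> past_causal_curve mink a b \<gamma>) \<and>
        \<gamma> a \<in> \<Omega> \<and> \<gamma> b \<in> \<Omega> \<longrightarrow> \<gamma> ` {a..b} \<subseteq> \<Omega>)"

definition future_complete :: "'n::finite minkowski set \<Rightarrow> bool" where
  "future_complete \<Omega> \<longleftrightarrow>
     (\<forall>a b \<gamma>. future_causal_curve mink a b \<gamma> \<and> \<gamma> a \<in> \<Omega> \<longrightarrow> \<gamma> ` {a..b} \<subseteq> \<Omega>)"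

definition past_complete :: "'n::finite minkowski set \<Rightarrow> bool" where
  "past_complete \<Omega> \<longleftrightarrow>
     (\<forall>a b \<gamma>. past_causal_curve mink a b \<gamma> \<and> \<gamma> a \<in> \<Omega> \<longrightarrow> \<gamma> ` {a..b} \<subseteq> \<Omega>)"


definition time_sep :: "'n::finite minkowski \<Rightarrow> 'n minkowski \<Rightarrow> real" where
  "time_sep x y = sqrt \<bar>mink (y - x) (y - x)\<bar>"

text \<open>The suprema are taken in the reals and are meaningful only when finite.  This is the
  case as soon as the corresponding causal boundary is nonempty and stably acausal, because
  then \<open>\<Omega> \<inter> J\<^sup>\<plusminus>(x)\<close> is bounded.\<close>

definition tau_future :: "'n::finite minkowski set \<Rightarrow> 'n minkowski \<Rightarrow> real" where
  "tau_future \<Omega> x = (SUP y\<in>\<Omega> \<inter> J_future x. time_sep x y)"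

definition tau_past :: "'n::finite minkowski set \<Rightarrow> 'n minkowski \<Rightarrow> real" where
  "tau_past \<Omega> x = (SUP y\<in>\<Omega> \<inter> J_past x. time_sep x y)"


definition null_distance ::
    "'n::finite minkowski set \<Rightarrow> ('n minkowski \<Rightarrow> real) \<Rightarrow> 'n minkowski \<Rightarrow> 'n minkowski \<Rightarrow> real" where
  "null_distance \<Omega> T x y =
     Inf {(\<Sum>k\<in>{1..<m}. \<bar>T (z (k + 1)) - T (z k)\<bar>) | (m::nat) (z :: nat \<Rightarrow> 'n minkowski).
            m \<ge> 1 \<and> z 1 = x \<and> z m = y \<and> (\<forall>k\<in>{1..m}. z k \<in> \<Omega>) \<and>
            (\<forall>k\<in>{1..<m}. causally_related mink (z k) (z (k + 1)))}"


abbreviation I_int :: "real set" where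
  "I_int \<equiv> {-1<..<1}"

definition rho_I :: "real \<Rightarrow> real \<Rightarrow> real" where
  "rho_I s t = \<bar>ln (((s - 1) * (t + 1)) / ((s + 1) * (t - 1)))\<bar>"

definition homography_on_I :: "(real \<Rightarrow> real) \<Rightarrow> bool" where
  "homography_on_I h \<longleftrightarrow>
     (\<exists>a b c d. a * d - b * c \<noteq> 0 \<and>
        (\<forall>s\<in>I_int. c * s + d \<noteq> 0 \<and> h s = (a * s + b) / (c * s + d)))"

definition proj_lightlike_geodesic :: "'n::finite minkowski set \<Rightarrow> (real \<Rightarrow> 'n minkowski) \<Rightarrow> bool" where
  "proj_lightlike_geodesic \<Omega> \<gamma> \<longleftrightarrow>
     (\<exists>x v h. lightlike mink v \<and> homography_on_I h \<and>
        (\<forall>s\<in>I_int. \<gamma> s = x + h s *\<^sub>R v \<and> \<gamma> s \<in> \<Omega>))"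

definition markowitz ::
    "'n::finite minkowski set \<Rightarrow> 'n minkowski \<Rightarrow> 'n minkowski \<Rightarrow> real" where
  "markowitz \<Omega> x y =
     Inf {(\<Sum>k\<in>{1..m}. rho_I (s k) (t k)) |
            (m::nat) (\<gamma> :: nat \<Rightarrow> real \<Rightarrow> 'n minkowski) (s :: nat \<Rightarrow> real) (t :: nat \<Rightarrow> real).
            m \<ge> 1 \<and>
            (\<forall>k\<in>{1..m}. proj_lightlike_geodesic \<Omega> (\<gamma> k) \<and> s k \<in> I_int \<and> t k \<in> I_int) \<and>
            \<gamma> 1 (s 1) = x \<and> \<gamma> m (t m) = y \<and>
            (\<forall>k\<in>{1..<m}. \<gamma> k (t k) = \<gamma> (k + 1) (s (k + 1)))}"


text \<open>For functions with values in the extended reals this says: finite and 1-Lipschitz, or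
  constantly \<open>\<infinity>\<close>, or constantly \<open>-\<infinity>\<close>.\<close>

definition ext_one_lipschitz_on :: "'a::metric_space set \<Rightarrow> ('a \<Rightarrow> ereal) \<Rightarrow> bool" where
  "ext_one_lipschitz_on S f \<longleftrightarrow> (\<forall>p\<in>S. \<forall>q\<in>S. f p \<le> f q + ereal (dist p q))"

definition graph_presentation ::
    "'n::finite minkowski set \<Rightarrow> (real ^ 'n) set \<Rightarrow> (real ^ 'n \<Rightarrow> ereal) \<Rightarrow> (real ^ 'n \<Rightarrow> ereal) \<Rightarrow> bool" where
  "graph_presentation \<Omega> U f_minus f_plus \<longleftrightarrow>
     open U \<and>
     ext_one_lipschitz_on (closure U) f_minus \<and> ext_one_lipschitz_on (closure U) f_plus \<and>
     (\<forall>p\<in>U. f_minus p < f_plus p) \<and> (\<forall>p\<in>frontier U. f_minus p = f_plus p) \<and>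
     \<Omega> = {(t, p). p \<in> U \<and> f_minus p < ereal t \<and> ereal t < f_plus p}"

text \<open>Every causally convex domain has a presentation, and \<open>U\<close> as well as the values of both
  functions on \<open>closure U\<close> are determined by \<open>\<Omega>\<close>; hence the existential quantifiers below
  range over essentially one triple.\<close>

definition future_causal_boundary :: "'n::finite minkowski set \<Rightarrow> 'n minkowski set" where
  "future_causal_boundary \<Omega> =
     {(t, p). \<exists>U f_minus f_plus. graph_presentation \<Omega> U f_minus f_plus \<and>
        p \<in> closure U \<and> ereal t = f_plus p}"

definition past_causal_boundary :: "'n::finite minkowski set \<Rightarrow> 'n minkowski set" where
  "past_causal_boundary \<Omega> =
     {(t, p). \<exists>U f_minus f_plus. graph_presentation \<Omega> U f_minus f_plus \<and>
        p \<in> closure U \<and> ereal t = f_minus p}"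

definition stably_acausal :: "real \<Rightarrow> 'n::finite minkowski set \<Rightarrow> bool" where
  "stably_acausal \<epsilon> A \<longleftrightarrow>
     (\<forall>x\<in>A. \<forall>y\<in>A. x \<noteq> y \<longrightarrow> \<not> causally_related (mink_eps \<epsilon>) x y)"

definition c_eps :: "real \<Rightarrow> real" where
  "c_eps \<epsilon> = \<epsilon> / sqrt (2 + 2 * (1 + \<epsilon>)\<^sup>2) * ln (((1 + \<epsilon>)\<^sup>2 + 1) / ((1 + \<epsilon>)\<^sup>2 - 1))"

end

theory Submission
  imports Defs
begin

text \<open>Stable acausality makes both boundary functions Lipschitz with constant \<open>L = 1 / (1 + \<epsilon>)\<close>, and the causal
  past of a point inside \<open>\<Omega>\<close> is cut out by the epigraph of an \<open>L\<close>-Lipschitz function on the whole space.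
  On a maximal null segment of \<open>\<Omega>\<close>, with affine distances \<open>a\<close> and \<open>b\<close> to its past and future end points, the
  Markowitz distance is the variation of \<open>ln (a / b)\<close>.  The square of \<open>\<tau>\<^sup>-\<close> is a supremum of functions that
  are affine along null rays, which yields \<open>d ln a \<le> 2 d ln \<tau>\<^sup>-\<close> because the past end point is not
  timelike related to the points of the past boundary.  Conversely \<open>d ln \<tau>\<^sup>- \<le> M d ln a\<close> with
  \<open>M = (1 + L) / (1 - L)\<close>, since the supremum may be taken over points seen under slope at most \<open>L\<close>.
  As \<open>M\<close> is at most the reciprocal of \<open>\<epsilon> / sqrt (2 + 2 (1 + \<epsilon>)\<^sup>2)\<close>, the two comparisons, applied to
  chains of null segments, give the theorem even without the additive constant.  The future is treated by reflection in
  time.\<close>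

section \<open>Causal curves and the cone order\<close>

text \<open>The suprema defining the cosmological times are not attained, because the boundary
  itself is excluded, and nothing is differentiated. Every rate along a null ray is therefore a
  finite inequality, proved for each competitor \<open>z\<close> and then passed through the
  supremum. Separations are affine along null rays because their quadratic coefficient is the metric
  on the direction of the ray. The rate from above arises as follows. A competitor at time depth
  \<alpha> and spatial distance r changes its separation at rate at most 2 (\<alpha> + r). If r
  \<le> L \<alpha>, then (\<alpha> + r) / (\<alpha> - r) \<le> M, so (\<alpha> + r)^2 is at most M
  times the squared time. Tilting a null segment of length a to slope L shows the same for a^2.
  Hence (\<alpha> + r) a is at most M times the squared time, and 2 (\<alpha> + r) at most 2 M / a
  times it. Working with finite steps doubles M. This is affordable: the 2 in the denominator of the
  left coefficient cancels it, and what remains is (2 + \<epsilon>)^2 \<le> 2 + 2 (1 +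
  \<epsilon>)^2.\<close>

definition cone_le :: "'n::finite minkowski \<Rightarrow> 'n minkowski \<Rightarrow> bool" where
  "cone_le x y \<longleftrightarrow> norm (snd y - snd x) \<le> fst y - fst x"

lemma cone_le_refl [simp]: "cone_le x x"
  by (simp add: cone_le_def)

lemma cone_le_dist: "cone_le x y \<longleftrightarrow> dist (snd x) (snd y) \<le> fst y - fst x"
  by (simp add: cone_le_def dist_norm norm_minus_commute)

lemma cone_le_trans:
  assumes "cone_le x y" "cone_le y z"
  shows "cone_le x z"
  using assms norm_triangle_ineq[of "snd z - snd y" "snd y - snd x"]
  by (simp add: cone_le_def)

lemma mink_self: "mink v v = (norm (snd v))\<^sup>2 - (fst v)\<^sup>2"
  by (simp add: mink_def power2_norm_eq_inner power2_eq_square[of "fst v"])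

lemma mink_eps_self: "mink_eps \<epsilon> v v = (norm (snd v))\<^sup>2 - ((1 + \<epsilon>) * fst v)\<^sup>2"
  by (simp add: mink_eps_def power2_norm_eq_inner power_mult_distrib power2_eq_square[of "fst v"])

lemma future_causal_mink_iff: "future_causal mink v \<longleftrightarrow> v \<noteq> 0 \<and> norm (snd v) \<le> fst v"
proof
  assume "future_causal mink v"
  then have "v \<noteq> 0" "(norm (snd v))\<^sup>2 \<le> (fst v)\<^sup>2" "fst v > 0"
    by (auto simp: future_causal_def causal_def mink_self mink_def time_dir_def)
  then show "v \<noteq> 0 \<and> norm (snd v) \<le> fst v"
    using power2_le_imp_le[of "norm (snd v)" "fst v"] by simp
next
  assume *: "v \<noteq> 0 \<and> norm (snd v) \<le> fst v"
  then have "(norm (snd v))\<^sup>2 \<le> (fst v)\<^sup>2"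
    by (simp add: power_mono)
  moreover have "fst v > 0"
  proof -
    have "0 \<le> fst v"
      using conjunct2[OF *] norm_ge_zero order_trans by blast
    moreover have "fst v \<noteq> 0"
    proof
      assume "fst v = 0"
      moreover from this have "snd v = 0" using conjunct2[OF *] by (metis norm_le_zero_iff)
      ultimately have "v = 0" by (metis prod_eqI fst_zero snd_zero)
      then show False using conjunct1[OF *] by blast
    qed
    ultimately show ?thesis by linarith
  qed
  ultimately show "future_causal mink v"
    using * by (simp add: future_causal_def causal_def mink_self mink_def time_dir_def)
qed

lemma past_causal_mink_imp:
  assumes "past_causal mink v"
  shows "norm (snd v) \<le> - fst v"
proof -
  have "(norm (snd v))\<^sup>2 \<le> (- fst v)\<^sup>2" "- fst v \<ge> 0"
    using assms by (auto simp: past_causal_def causal_def mink_self mink_def time_dir_def)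
  then show ?thesis by (rule power2_le_imp_le)
qed

text \<open>Velocities are tested with linear functionals instead of being integrated: the mean
  value theorem gives monotonicity on each smooth piece, and induction over the breakpoints glues
  the pieces.\<close>

lemma piecewise_smooth_curve_mono:
  assumes "piecewise_smooth_curve P a b \<gamma>" and f: "bounded_linear f"
    and P: "\<And>v. P v \<Longrightarrow> 0 \<le> f v" and s: "s \<in> {a..b}"
  shows "(f (\<gamma> a) :: real) \<le> f (\<gamma> s)"
proof -
  obtain m \<sigma> where m: "\<sigma> 0 = a" "\<sigma> m = b"
    and pc: "\<And>i. i < m \<Longrightarrow> \<sigma> i < \<sigma> (Suc i)"
      "\<And>i. i < m \<Longrightarrow> smooth_curve_on {\<sigma> i..\<sigma> (Suc i)} \<gamma>"
      "\<And>i r. i < m \<Longrightarrow> r \<in> {\<sigma> i..\<sigma> (Suc i)} \<Longrightarrow> P (vector_derivative \<gamma> (at r within {\<sigma> i..\<sigma> (Suc i)}))"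
    using assms(1) unfolding piecewise_smooth_curve_def by blast
  have piece: "f (\<gamma> (\<sigma> i)) \<le> f (\<gamma> r)" if i: "i < m" and r: "r \<in> {\<sigma> i..\<sigma> (Suc i)}" for i r
  proof (cases "r = \<sigma> i")
    case False
    then have lt: "\<sigma> i < r" using r by simp
    let ?S = "{\<sigma> i..\<sigma> (Suc i)}"
    let ?d = "\<lambda>q. vector_derivative \<gamma> (at q within ?S)"
    have "((\<lambda>q. f (\<gamma> q)) has_derivative (\<lambda>h. f (h *\<^sub>R ?d q))) (at q within {\<sigma> i..r})"
      if q: "\<sigma> i \<le> q" "q \<le> r" for q
    proof -
      have "q \<in> ?S" using q r by auto
      then have "\<gamma> differentiable (at q within ?S)"
        using pc(2)[OF i] unfolding smooth_curve_on_def by (metis differentiableI_vector)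
      then have "(\<gamma> has_vector_derivative ?d q) (at q within ?S)"
        by (simp add: vector_derivative_works)
      then have "(\<gamma> has_derivative (\<lambda>h. h *\<^sub>R ?d q)) (at q within {\<sigma> i..r})"
        unfolding has_vector_derivative_def by (rule has_derivative_subset) (use r in auto)
      then show ?thesis
        using bounded_linear.has_derivative[OF f] by blast
    qed
    then obtain q where q: "q \<in> {\<sigma> i<..<r}"
      and eq: "f (\<gamma> r) - f (\<gamma> (\<sigma> i)) = f ((r - \<sigma> i) *\<^sub>R ?d q)"
      using mvt_simple[OF lt, of "\<lambda>q. f (\<gamma> q)" "\<lambda>q h. f (h *\<^sub>R ?d q)"] by blast
    have "0 \<le> f (?d q)" using P pc(3)[OF i] q r by auto
    then have "0 \<le> f ((r - \<sigma> i) *\<^sub>R ?d q)"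
      using lt by (simp add: linear_scale bounded_linear.linear[OF f])
    then show ?thesis using eq by simp
  qed simp
  have "\<sigma> 0 \<le> \<sigma> i \<and> (\<forall>r\<in>{\<sigma> 0..\<sigma> i}. f (\<gamma> (\<sigma> 0)) \<le> f (\<gamma> r))" if "i \<le> m" for i
    using that
  proof (induction i)
    case (Suc i)
    then have i: "i < m" and IH: "\<sigma> 0 \<le> \<sigma> i" "\<And>r. r \<in> {\<sigma> 0..\<sigma> i} \<Longrightarrow> f (\<gamma> (\<sigma> 0)) \<le> f (\<gamma> r)"
      by auto
    have "f (\<gamma> (\<sigma> 0)) \<le> f (\<gamma> r)" if r: "r \<in> {\<sigma> 0..\<sigma> (Suc i)}" for r
    proof (cases "r \<le> \<sigma> i")
      case False
      then show ?thesis using IH(2)[of "\<sigma> i"] IH(1) piece[OF i, of r] r by auto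
    qed (use IH r in auto)
    then show ?case using IH(1) pc(1)[OF i] by auto
  qed simp
  then show ?thesis using s m by blast
qed

text \<open>The solid cone is an intersection of half spaces, and the one along \<open>snd v\<close>
  is decisive. Allowing \<open>norm u \<le> 1\<close> covers \<open>sgn 0 = 0\<close>.\<close>

lemma norm_snd_le_if_dual:
  fixes v :: "'n::finite minkowski"
  assumes "\<And>u. norm u \<le> 1 \<Longrightarrow> u \<bullet> snd v \<le> c"
  shows "norm (snd v) \<le> c"
proof -
  have "sgn (snd v) \<bullet> snd v = norm (snd v)"
    by (cases "snd v = 0") (simp_all add: sgn_div_norm dot_square_norm power2_eq_square)
  then show ?thesis using assms[of "sgn (snd v)"] by (simp add: norm_sgn)
qed

lemma future_causal_curve_cone_le:
  fixes \<gamma> :: "real \<Rightarrow> 'n::finite minkowski"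
  assumes "future_causal_curve mink a b \<gamma>" "s \<in> {a..b}"
  shows "cone_le (\<gamma> a) (\<gamma> s)"
  unfolding cone_le_def fst_diff[symmetric] snd_diff[symmetric]
proof (rule norm_snd_le_if_dual)
  fix u :: "real ^ 'n" assume u: "norm u \<le> 1"
  have "fst (\<gamma> a) - u \<bullet> snd (\<gamma> a) \<le> fst (\<gamma> s) - u \<bullet> snd (\<gamma> s)"
  proof (rule piecewise_smooth_curve_mono[OF assms(1)[unfolded future_causal_curve_def] _ _ assms(2)])
    show "bounded_linear (\<lambda>v. fst v - u \<bullet> snd v)"
      by (intro bounded_linear_intros)
    show "0 \<le> fst v - u \<bullet> snd v" if "future_causal mink v" for v
      using that norm_cauchy_schwarz[of u "snd v"] mult_right_mono[OF u norm_ge_zero[of "snd v"]]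
      by (simp add: future_causal_mink_iff)
  qed
  then show "u \<bullet> snd (\<gamma> s - \<gamma> a) \<le> fst (\<gamma> s - \<gamma> a)"
    by (simp add: inner_diff_right)
qed

lemma past_causal_curve_cone_le:
  fixes \<gamma> :: "real \<Rightarrow> 'n::finite minkowski"
  assumes "past_causal_curve mink a b \<gamma>" "s \<in> {a..b}"
  shows "cone_le (\<gamma> s) (\<gamma> a)"
  unfolding cone_le_def fst_diff[symmetric] snd_diff[symmetric]
proof (rule norm_snd_le_if_dual)
  fix u :: "real ^ 'n" assume u: "norm u \<le> 1"
  have "u \<bullet> snd (\<gamma> a) - fst (\<gamma> a) \<le> u \<bullet> snd (\<gamma> s) - fst (\<gamma> s)"
  proof (rule piecewise_smooth_curve_mono[OF assms(1)[unfolded past_causal_curve_def] _ _ assms(2)])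
    show "bounded_linear (\<lambda>v. u \<bullet> snd v - fst v)"
      by (intro bounded_linear_intros)
    show "0 \<le> u \<bullet> snd v - fst v" if "past_causal mink v" for v
      using past_causal_mink_imp[OF that] norm_cauchy_schwarz[of "- u" "snd v"]
        mult_right_mono[OF u norm_ge_zero[of "snd v"]]
      by simp
  qed
  then show "u \<bullet> snd (\<gamma> a - \<gamma> s) \<le> fst (\<gamma> a - \<gamma> s)"
    by (simp add: inner_diff_right)
qed

section \<open>Straight and broken causal lines\<close>

lemma affine_smooth_curve:
  assumes "\<And>s. s \<in> S \<Longrightarrow> \<gamma> s = x + s *\<^sub>R v"
  shows "smooth_curve_on S \<gamma>"
  unfolding smooth_curve_on_def
proof (intro exI[of _ "\<lambda>k. if k = 0 then \<gamma> else if k = 1 then (\<lambda>_. v) else (\<lambda>_. 0)"] conjI allI ballI)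
  fix k s assume s: "s \<in> S"
  have "(\<gamma> has_vector_derivative v) (at s within S)"
    by (rule has_vector_derivative_transform[OF s assms]) (auto intro!: derivative_eq_intros)
  then show "((if k = 0 then \<gamma> else if k = 1 then \<lambda>_. v else (\<lambda>_. 0)) has_vector_derivative
      (if Suc k = 0 then \<gamma> else if Suc k = 1 then \<lambda>_. v else (\<lambda>_. 0)) s) (at s within S)"
    by auto
qed simp

lemma affine_vector_derivative:
  assumes "\<And>s. s \<in> {a..b} \<Longrightarrow> \<gamma> s = x + s *\<^sub>R v" "a < b" "s \<in> {a..b}"
  shows "vector_derivative \<gamma> (at s within {a..b}) = v"
proof -
  have "(\<gamma> has_vector_derivative v) (at s within {a..b})"
    by (rule has_vector_derivative_transform[OF assms(3,1)]) (auto intro!: derivative_eq_intros)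
  then show ?thesis
    using assms(2,3) vector_derivative_within_cbox[of a b s \<gamma> v] by auto
qed

text \<open>Stated for arbitrary \<open>g\<close>, since \<open>stably_acausal_slope\<close> applies
  it to \<open>mink_eps\<close>.\<close>

lemma causal_le_straight:
  assumes "future_causal g (y - x)"
  shows "causal_le g x y"
proof -
  let ?\<gamma> = "\<lambda>s. x + s *\<^sub>R (y - x)"
  have "smooth_curve_on {0..1} ?\<gamma>"
    by (rule affine_smooth_curve) simp
  moreover have "vector_derivative ?\<gamma> (at s within {0..1}) = y - x" if "s \<in> {0..1}" for s
    by (rule affine_vector_derivative[OF _ _ that]) simp_all
  ultimately have "piecewise_smooth_curve (future_causal g) 0 1 ?\<gamma>"
    unfolding piecewise_smooth_curve_def
    by (intro exI[of _ 1] exI[of _ real]) (simp add: assms)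
  then show ?thesis
    unfolding causal_le_def future_causal_curve_def
    by (intro disjI2 exI[of _ 0] exI[of _ 1] exI[of _ ?\<gamma>]) simp
qed

text \<open>Trades the existence of a curve for one inequality; the cosmological times and the
  chains are handled through it.\<close>

lemma causal_le_mink_iff: "causal_le mink x y \<longleftrightarrow> cone_le x y"
proof
  assume "causal_le mink x y"
  then show "cone_le x y"
    unfolding causal_le_def
  proof
    assume "\<exists>a b \<gamma>. future_causal_curve mink a b \<gamma> \<and> \<gamma> a = x \<and> \<gamma> b = y"
    then obtain a b \<gamma> where *: "future_causal_curve mink a b \<gamma>" "\<gamma> a = x" "\<gamma> b = y" by blast
    then obtain m \<sigma> where \<sigma>: "\<sigma> 0 = a" "\<sigma> m = b" "\<And>i. i < m \<Longrightarrow> \<sigma> i < \<sigma> (Suc i)"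
      unfolding future_causal_curve_def piecewise_smooth_curve_def by blast
    have "\<sigma> 0 \<le> \<sigma> i" if "i \<le> m" for i
      using that
    proof (induction i)
      case (Suc i)
      then show ?case using \<sigma>(3)[of i] by simp
    qed simp
    then have "a \<le> b" using \<sigma> by auto
    then show ?thesis
      using future_causal_curve_cone_le[OF *(1), of b] * by auto
  qed simp
next
  assume "cone_le x y"
  then show "causal_le mink x y"
    using causal_le_straight[of mink y x]
    by (cases "x = y") (simp_all add: causal_le_def[of _ y y] cone_le_def future_causal_mink_iff)
qed

text \<open>The broken line from \<open>x\<close> through \<open>z\<close> to \<open>w\<close> is a
  causal curve. If two consecutive points coincide, a piece would have zero velocity, which is not
  causal; hence the case distinction.\<close>

lemma causally_convex_between:
  assumes cc: "causally_convex \<Omega>" and x: "x \<in> \<Omega>" and w: "w \<in> \<Omega>"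
    and xz: "cone_le x z" and zw: "cone_le z w"
  shows "z \<in> \<Omega>"
proof (cases "x = z \<or> z = w")
  case False
  define \<gamma> where "\<gamma> s = (if s \<le> 1 then x + s *\<^sub>R (z - x) else (z - (w - z)) + s *\<^sub>R (w - z))" for s :: real
  have fc: "future_causal mink (z - x)" "future_causal mink (w - z)"
    using False xz zw by (auto simp: cone_le_def future_causal_mink_iff)
  have \<gamma>1: "\<gamma> s = x + s *\<^sub>R (z - x)" if "s \<in> {0..1}" for s
    using that by (simp add: \<gamma>_def)
  have \<gamma>2: "\<gamma> s = (z - (w - z)) + s *\<^sub>R (w - z)" if "s \<in> {1..2}" for s
    using that by (cases "s = 1") (auto simp: \<gamma>_def)
  have smooth: "smooth_curve_on {0..1} \<gamma>" "smooth_curve_on {1..2} \<gamma>"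
    by (rule affine_smooth_curve, erule \<gamma>1, rule affine_smooth_curve, erule \<gamma>2)
  have "piecewise_smooth_curve (future_causal mink) 0 2 \<gamma>"
    unfolding piecewise_smooth_curve_def
  proof (rule exI[of _ 2], rule exI[of _ real], intro conjI allI impI ballI)
    fix i :: nat assume "i < 2"
    then have "i = 0 \<or> i = 1" by linarith
    then consider "{real i..real (Suc i)} = {0..1}" | "{real i..real (Suc i)} = {1..2}" by fastforce
    note cs = this
    show "smooth_curve_on {real i..real (Suc i)} \<gamma>"
      using cs by cases (simp_all only: smooth)
    fix s assume s: "s \<in> {real i..real (Suc i)}"
    have "vector_derivative \<gamma> (at s within {real i..real (Suc i)}) \<in> {z - x, w - z}"
      using cs
    proof cases
      case 1
      then show ?thesis using affine_vector_derivative[OF \<gamma>1, of 0 1 s] s by simp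
    next
      case 2
      then show ?thesis using affine_vector_derivative[OF \<gamma>2, of 1 2 s] s by simp
    qed
    then show "future_causal mink (vector_derivative \<gamma> (at s within {real i..real (Suc i)}))"
      using fc by auto
  qed auto
  then have fcc: "future_causal_curve mink 0 2 \<gamma>"
    by (simp add: future_causal_curve_def)
  have \<gamma>: "\<gamma> 0 = x" "\<gamma> 1 = z" "\<gamma> 2 = w"
    by (simp_all add: \<gamma>_def scaleR_2)
  have "\<gamma> ` {0..2} \<subseteq> \<Omega>"
    using cc[unfolded causally_convex_def, rule_format, of 0 2 \<gamma>] fcc \<gamma> x w by simp
  moreover have "\<gamma> 1 \<in> \<gamma> ` {0..2}" by (rule imageI) simp
  ultimately show ?thesis using \<gamma>(2) by blast
qed (use x w in auto)

section \<open>The boundary functions of a causally convex domain\<close>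

text \<open>The graph bounds the union of the open future cones of the points of
  \<open>\<Omega>\<close>. As an infimum of cone functions it is defined over the whole space and
  1-Lipschitz without reference to the base \<open>U\<close>; extended values cover complete
  domains.\<close>

definition lower_boundary :: "'n::finite minkowski set \<Rightarrow> real ^ 'n \<Rightarrow> ereal" where
  "lower_boundary \<Omega> p = (INF z\<in>\<Omega>. ereal (fst z + dist p (snd z)))"

definition upper_boundary :: "'n::finite minkowski set \<Rightarrow> real ^ 'n \<Rightarrow> ereal" where
  "upper_boundary \<Omega> p = (SUP z\<in>\<Omega>. ereal (fst z - dist p (snd z)))"

lemma lower_boundary_less_iff:
  "lower_boundary \<Omega> (snd x) < ereal (fst x) \<longleftrightarrow> (\<exists>z\<in>\<Omega>. dist (snd x) (snd z) < fst x - fst z)"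
  by (auto simp: lower_boundary_def INF_less_iff algebra_simps)

lemma upper_boundary_greater_iff:
  "ereal (fst x) < upper_boundary \<Omega> (snd x) \<longleftrightarrow> (\<exists>z\<in>\<Omega>. dist (snd x) (snd z) < fst z - fst x)"
  by (auto simp: upper_boundary_def less_SUP_iff algebra_simps)

lemma lower_boundary_lipschitz: "ext_one_lipschitz_on S (lower_boundary \<Omega>)"
  unfolding ext_one_lipschitz_on_def
proof (intro ballI)
  fix p q
  have "lower_boundary \<Omega> p - ereal (dist p q) \<le> lower_boundary \<Omega> q"
    unfolding lower_boundary_def[of _ q]
  proof (rule INF_greatest)
    fix z assume "z \<in> \<Omega>"
    then have "lower_boundary \<Omega> p \<le> ereal (fst z + dist p (snd z))"
      unfolding lower_boundary_def by (rule INF_lower)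
    also have "\<dots> \<le> ereal (fst z + dist q (snd z)) + ereal (dist p q)"
      using dist_triangle[of p "snd z" q] by simp
    finally show "lower_boundary \<Omega> p - ereal (dist p q) \<le> ereal (fst z + dist q (snd z))"
      by (simp add: ereal_minus_le)
  qed
  then show "lower_boundary \<Omega> p \<le> lower_boundary \<Omega> q + ereal (dist p q)"
    by (simp add: ereal_minus_le)
qed

lemma upper_boundary_lipschitz: "ext_one_lipschitz_on S (upper_boundary \<Omega>)"
  unfolding ext_one_lipschitz_on_def
proof (intro ballI)
  fix p q
  show "upper_boundary \<Omega> p \<le> upper_boundary \<Omega> q + ereal (dist p q)"
    unfolding upper_boundary_def[of _ p]
  proof (rule SUP_least)
    fix z assume "z \<in> \<Omega>"
    then have "ereal (fst z - dist q (snd z)) \<le> upper_boundary \<Omega> q"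
      unfolding upper_boundary_def by (rule SUP_upper)
    then have "ereal (fst z - dist q (snd z)) + ereal (dist p q) \<le> upper_boundary \<Omega> q + ereal (dist p q)"
      by (rule add_right_mono)
    moreover have "ereal (fst z - dist p (snd z)) \<le> ereal (fst z - dist q (snd z)) + ereal (dist p q)"
      using dist_triangle[of q "snd z" p] by (simp add: dist_commute)
    ultimately show "ereal (fst z - dist p (snd z)) \<le> upper_boundary \<Omega> q + ereal (dist p q)"
      by (rule order_trans[rotated])
  qed
qed

lemma causally_convex_between_boundaries:
  assumes "causally_convex \<Omega>"
    and "lower_boundary \<Omega> (snd x) < ereal (fst x)" "ereal (fst x) < upper_boundary \<Omega> (snd x)"
  shows "x \<in> \<Omega>"
proof -
  obtain z w where "z \<in> \<Omega>" "dist (snd x) (snd z) < fst x - fst z"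
    and "w \<in> \<Omega>" "dist (snd x) (snd w) < fst w - fst x"
    using assms(2,3) unfolding lower_boundary_less_iff upper_boundary_greater_iff by blast
  then show ?thesis
    using causally_convex_between[OF assms(1), of z w x]
    by (metis cone_le_dist dist_commute less_imp_le)
qed

lemma boundaries_around:
  assumes "open \<Omega>" "x \<in> \<Omega>"
  shows "lower_boundary \<Omega> (snd x) < ereal (fst x)" "ereal (fst x) < upper_boundary \<Omega> (snd x)"
proof -
  obtain e where e: "e > 0" "\<And>y. dist y x < e \<Longrightarrow> y \<in> \<Omega>"
    using assms unfolding open_dist by blast
  have "(fst x + e/2, snd x) \<in> \<Omega>" "(fst x - e/2, snd x) \<in> \<Omega>"
    using e(1) by (auto intro!: e(2) simp: dist_prod_def dist_real_def)
  then show "lower_boundary \<Omega> (snd x) < ereal (fst x)" "ereal (fst x) < upper_boundary \<Omega> (snd x)"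
    unfolding lower_boundary_less_iff upper_boundary_greater_iff using e(1) by force+
qed

text \<open>Supplies the witness for the existential quantifiers in both causal boundaries. Over the
  frontier, \<le> follows from \<le> over nearby base points by the Lipschitz bounds; a strict
  inequality would put a point of \<open>\<Omega>\<close> over \<open>p\<close>, although the base
  is open.\<close>

lemma graph_presentation_boundaries:
  fixes \<Omega> :: "'n::finite minkowski set"
  assumes cc: "causally_convex \<Omega>" and op: "open \<Omega>"
  shows "graph_presentation \<Omega> (snd ` \<Omega>) (lower_boundary \<Omega>) (upper_boundary \<Omega>)"
proof -
  have "open (snd ` \<Omega>)" using op by (rule open_image_snd)
  have sub: "lower_boundary \<Omega> p < upper_boundary \<Omega> p" if p: "p \<in> snd ` \<Omega>" for p
    using p boundaries_around[OF op] by (force intro: less_trans)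
  have in_if: "(t, p) \<in> \<Omega>" if "lower_boundary \<Omega> p < ereal t" "ereal t < upper_boundary \<Omega> p" for t p
    using causally_convex_between_boundaries[OF cc, of "(t, p)"] that by simp
  have "lower_boundary \<Omega> p = upper_boundary \<Omega> p" if p: "p \<in> frontier (snd ` \<Omega>)" for p
  proof (rule antisym)
    show "lower_boundary \<Omega> p \<le> upper_boundary \<Omega> p"
    proof (rule ereal_le_epsilon2)
      fix e :: real assume "e > 0"
      moreover have "p \<in> closure (snd ` \<Omega>)" using p by (simp add: frontier_def)
      ultimately obtain q where q: "q \<in> snd ` \<Omega>" "dist q p < e / 2"
        unfolding closure_approachable by (metis half_gt_zero)
      have "lower_boundary \<Omega> p \<le> lower_boundary \<Omega> q + ereal (dist p q)"
        using lower_boundary_lipschitz[of UNIV \<Omega>] by (simp add: ext_one_lipschitz_on_def)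
      also have "\<dots> \<le> upper_boundary \<Omega> q + ereal (dist p q)"
        using sub[OF q(1)] by (intro add_right_mono) simp
      also have "\<dots> \<le> (upper_boundary \<Omega> p + ereal (dist p q)) + ereal (dist p q)"
        using upper_boundary_lipschitz[of UNIV \<Omega>] 
        by (intro add_right_mono) (metis UNIV_I dist_commute ext_one_lipschitz_on_def)
      also have "\<dots> = upper_boundary \<Omega> p + ereal (2 * dist p q)"
        by (simp add: add.assoc)
      also have "\<dots> \<le> upper_boundary \<Omega> p + ereal e"
        using q(2) by (intro add_left_mono) (simp add: dist_commute)
      finally show "lower_boundary \<Omega> p \<le> upper_boundary \<Omega> p + ereal e" .
    qed
  next
    show "upper_boundary \<Omega> p \<le> lower_boundary \<Omega> p"
    proof (rule ccontr)
      assume "\<not> ?thesis"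
      then obtain t where "lower_boundary \<Omega> p < ereal t" "ereal t < upper_boundary \<Omega> p"
        using ereal_dense2[of "lower_boundary \<Omega> p" "upper_boundary \<Omega> p"] by (auto simp: not_le)
      then have "p \<in> snd ` \<Omega>" using in_if by force
      moreover have "p \<notin> interior (snd ` \<Omega>)" using p by (simp add: frontier_def)
      ultimately show False using \<open>open (snd ` \<Omega>)\<close> by (simp add: interior_open)
    qed
  qed
  moreover have "\<Omega> = {(t, p). p \<in> snd ` \<Omega> \<and> lower_boundary \<Omega> p < ereal t \<and> ereal t < upper_boundary \<Omega> p}"
  proof (intro subset_antisym subsetI)
    fix x assume "x \<in> \<Omega>"
    then show "x \<in> {(t, p). p \<in> snd ` \<Omega> \<and> lower_boundary \<Omega> p < ereal t \<and> ereal t < upper_boundary \<Omega> p}"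
      using boundaries_around[OF op] by (auto simp: case_prod_beta)
  qed (auto intro: in_if)
  ultimately show ?thesis
    unfolding graph_presentation_def
    by (intro conjI ballI \<open>open (snd ` \<Omega>)\<close> sub lower_boundary_lipschitz upper_boundary_lipschitz)
qed

lemma ext_one_lipschitz_finite:
  assumes "ext_one_lipschitz_on UNIV F" "F p0 \<noteq> \<infinity>" "F p1 \<noteq> -\<infinity>"
  shows "\<bar>F p\<bar> \<noteq> \<infinity>"
proof -
  have "F p \<le> F p0 + ereal (dist p p0)" "F p1 \<le> F p + ereal (dist p1 p)"
    using assms(1) by (auto simp: ext_one_lipschitz_on_def)
  then show ?thesis using assms(2,3) by (cases "F p"; cases "F p0"; cases "F p1") auto
qed

text \<open>A past causal curve from \<open>\<Omega>\<close> reaches a point outside. That point has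
  no point of \<open>\<Omega>\<close> below it, by causal convexity, so the infimum is not
  -\<infinity> there; over a point of \<open>\<Omega>\<close> it is not \<infinity>. The Lipschitz
  bound spreads both facts.\<close>

lemma lower_boundary_finite:
  assumes "causally_convex \<Omega>" "\<Omega> \<noteq> {}" "\<not> past_complete \<Omega>"
  shows "\<bar>lower_boundary \<Omega> p\<bar> \<noteq> \<infinity>"
proof -
  obtain a b \<gamma> s where \<gamma>: "past_causal_curve mink a b \<gamma>" "\<gamma> a \<in> \<Omega>" and s: "s \<in> {a..b}" "\<gamma> s \<notin> \<Omega>"
    using assms(3) unfolding past_complete_def by blast
  obtain z where z: "z \<in> \<Omega>" using assms(2) by blast
  then have "lower_boundary \<Omega> (snd z) \<le> ereal (fst z + dist (snd z) (snd z))"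
    unfolding lower_boundary_def by (rule INF_lower)
  moreover have "\<not> lower_boundary \<Omega> (snd (\<gamma> s)) < ereal (fst (\<gamma> s))"
  proof
    assume "lower_boundary \<Omega> (snd (\<gamma> s)) < ereal (fst (\<gamma> s))"
    then obtain w where "w \<in> \<Omega>" "dist (snd (\<gamma> s)) (snd w) < fst (\<gamma> s) - fst w"
      unfolding lower_boundary_less_iff by blast
    then have "\<gamma> s \<in> \<Omega>"
      using causally_convex_between[OF assms(1) _ \<gamma>(2) _ past_causal_curve_cone_le[OF \<gamma>(1) s(1)], of w]
      by (metis cone_le_dist dist_commute less_imp_le)
    with s(2) show False by blast
  qed
  ultimately have "lower_boundary \<Omega> (snd z) \<noteq> \<infinity>" "lower_boundary \<Omega> (snd (\<gamma> s)) \<noteq> - \<infinity>"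
    by auto
  then show ?thesis by (rule ext_one_lipschitz_finite[OF lower_boundary_lipschitz])
qed

lemma upper_boundary_finite:
  assumes "causally_convex \<Omega>" "\<Omega> \<noteq> {}" "\<not> future_complete \<Omega>"
  shows "\<bar>upper_boundary \<Omega> p\<bar> \<noteq> \<infinity>"
proof -
  obtain a b \<gamma> s where \<gamma>: "future_causal_curve mink a b \<gamma>" "\<gamma> a \<in> \<Omega>" and s: "s \<in> {a..b}" "\<gamma> s \<notin> \<Omega>"
    using assms(3) unfolding future_complete_def by blast
  obtain z where z: "z \<in> \<Omega>" using assms(2) by blast
  then have "ereal (fst z - dist (snd z) (snd z)) \<le> upper_boundary \<Omega> (snd z)"
    unfolding upper_boundary_def by (rule SUP_upper)
  moreover have "\<not> ereal (fst (\<gamma> s)) < upper_boundary \<Omega> (snd (\<gamma> s))"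
  proof
    assume "ereal (fst (\<gamma> s)) < upper_boundary \<Omega> (snd (\<gamma> s))"
    then obtain w where "w \<in> \<Omega>" "dist (snd (\<gamma> s)) (snd w) < fst w - fst (\<gamma> s)"
      unfolding upper_boundary_greater_iff by blast
    then have "\<gamma> s \<in> \<Omega>"
      using causally_convex_between[OF assms(1) \<gamma>(2) _ future_causal_curve_cone_le[OF \<gamma>(1) s(1)], of w]
      by (metis cone_le_dist less_imp_le)
    with s(2) show False by blast
  qed
  ultimately have "upper_boundary \<Omega> (snd (\<gamma> s)) \<noteq> \<infinity>" "upper_boundary \<Omega> (snd z) \<noteq> - \<infinity>"
    by auto
  then show ?thesis by (rule ext_one_lipschitz_finite[OF upper_boundary_lipschitz])
qed

text \<open>The cone of \<open>mink_eps \<epsilon>\<close> is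
  \<open>norm (snd v) \<le> (1 + \<epsilon>) * fst v\<close>, so the straight segment along a
  steeper chord would be causal for it.\<close>

lemma stably_acausal_slope:
  fixes A :: "'n::finite minkowski set"
  assumes "stably_acausal \<epsilon> A" "\<epsilon> > 0" and x: "x \<in> A" and y: "y \<in> A"
  shows "\<bar>fst x - fst y\<bar> \<le> 1 / (1 + \<epsilon>) * dist (snd x) (snd y)"
proof -
  have *: "fst y - fst x \<le> 1 / (1 + \<epsilon>) * dist (snd x) (snd y)" if "x \<in> A" "y \<in> A" for x y
  proof (rule ccontr)
    assume "\<not> ?thesis"
    then have lt: "dist (snd x) (snd y) < (1 + \<epsilon>) * (fst y - fst x)"
      using assms(2) by (simp add: field_simps)
    then have "0 < (1 + \<epsilon>) * (fst y - fst x)" using zero_le_dist[of "snd x" "snd y"] by linarith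
    then have pos: "0 < fst y - fst x" using assms(2) by (simp add: zero_less_mult_iff)
    have "(norm (snd (y - x)))\<^sup>2 \<le> ((1 + \<epsilon>) * fst (y - x))\<^sup>2"
      using lt by (intro power_mono) (simp_all add: dist_norm norm_minus_commute)
    moreover have "y - x \<noteq> 0" "x \<noteq> y" using pos by auto
    ultimately have "future_causal (mink_eps \<epsilon>) (y - x)"
      using pos assms(2)
      by (simp add: future_causal_def causal_def mink_eps_self) (simp add: mink_eps_def time_dir_def)
    then have "causally_related (mink_eps \<epsilon>) x y"
      by (simp add: causally_related_def causal_le_straight)
    then show False using assms(1) that \<open>x \<noteq> y\<close> by (auto simp: stably_acausal_def)
  qed
  show ?thesis using *[OF x y] *[OF y x] by (simp add: dist_commute abs_le_iff)
qed

text \<open>The slope bound of the boundary functions holds only over \<open>closure U\<close>. An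
  extension with the same constant lets the later estimates move freely in space.\<close>

lemma mcshane_extension:
  fixes f :: "'a::metric_space \<Rightarrow> real"
  assumes "L-lipschitz_on S f" "S \<noteq> {}"
  shows "\<exists>g. L-lipschitz_on UNIV g \<and> (\<forall>x\<in>S. g x = f x)"
proof -
  define g where "g p = (INF q\<in>S. f q + L * dist p q)" for p
  have L: "L \<ge> 0" using assms(1) by (rule lipschitz_on_nonneg)
  obtain q0 where q0: "q0 \<in> S" using assms(2) by blast
  have f: "f p \<le> f q + L * dist p q" if "p \<in> S" "q \<in> S" for p q
    using lipschitz_onD[OF assms(1) that] by (simp add: dist_real_def abs_le_iff)
  have bdd: "bdd_below ((\<lambda>q. f q + L * dist p q) ` S)" for p
  proof (rule bdd_belowI2)
    fix q assume "q \<in> S"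
    then have "f q0 \<le> f q + L * (dist p q0 + dist p q)"
      using f[OF q0, of q] mult_left_mono[OF dist_triangle[of q0 q p] L]
      by (simp add: dist_commute)
    then show "f q0 - L * dist p q0 \<le> f q + L * dist p q" by (simp add: algebra_simps)
  qed
  have g: "g p \<le> f q + L * dist p q" if "q \<in> S" for p q
    unfolding g_def by (rule cINF_lower[OF bdd that])
  have le: "g p - L * dist p q \<le> g q" for p q
    unfolding g_def[of q]
  proof (rule cINF_greatest[OF assms(2)])
    fix r assume "r \<in> S"
    then show "g p - L * dist p q \<le> f r + L * dist q r"
      using g[of r p] mult_left_mono[OF dist_triangle[of p r q] L] by (simp add: algebra_simps)
  qed
  have "L-lipschitz_on UNIV g"
  proof (rule lipschitz_onI[OF _ L])
    fix p q
    show "dist (g p) (g q) \<le> L * dist p q"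
      using le[of p q] le[of q p] by (simp add: dist_real_def abs_le_iff dist_commute)
  qed
  moreover have "g x = f x" if "x \<in> S" for x
  proof (rule antisym)
    show "g x \<le> f x" using g[OF that, of x] by simp
    show "f x \<le> g x" unfolding g_def by (rule cINF_greatest[OF assms(2)]) (use f that in auto)
  qed
  ultimately show ?thesis by blast
qed

text \<open>A segment leaving \<open>U\<close> would cross the frontier below \<open>f\<close> and above \<open>G\<close>, which agree there.\<close>

lemma cone_le_stays_over:
  fixes G f :: "real ^ 'n::finite \<Rightarrow> real"
  assumes f: "1-lipschitz_on (closure U) f" and G: "L-lipschitz_on UNIV G" and L: "L \<le> 1"
    and rim: "\<And>p. p \<in> frontier U \<Longrightarrow> f p = G p"
    and p: "p \<in> U" "t < f p" and q: "dist p q \<le> t - s" "G q < s"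
  shows "q \<in> U"
proof (rule ccontr)
  assume "q \<notin> U"
  then have "closed_segment p q \<inter> frontier U \<noteq> {}"
    using p(1) by (intro connected_Int_frontier) auto
  then obtain r where r: "r \<in> closed_segment p q" "r \<in> frontier U" by blast
  have d: "dist p r + dist r q = dist p q"
    using r(1) between_mem_segment[of p q r] by (simp add: between)
  have "p \<in> closure U" "r \<in> closure U"
    using p(1) r(2) by (auto simp: frontier_def closure_subset[THEN subsetD])
  then have "f p \<le> f r + dist p r"
    using lipschitz_onD[OF f, of p r] by (simp add: dist_real_def abs_le_iff)
  moreover have "G r \<le> G q + L * dist r q"
    using lipschitz_onD[OF G, of r q] by (simp add: dist_real_def abs_le_iff)
  moreover have "L * dist r q \<le> dist r q"
    using mult_right_mono[OF L zero_le_dist[of r q]] by simp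
  \<comment> \<open>The chain is \<open>t < f p \<le> G r + dist p r \<le> G q + dist p q < s + (t -
    s)\<close>.\<close>
  ultimately show False using rim[OF r(2)] d p(2) q by linarith
qed

text \<open>Membership is characterised only for \<open>z\<close> causally related to a point of
  \<open>\<Omega>\<close>: elsewhere \<open>snd z\<close> may leave the base, where the extensions
  say nothing about \<open>\<Omega>\<close>.\<close>

lemma stably_acausal_slab:
  fixes \<Omega> :: "'n::finite minkowski set"
  assumes \<epsilon>: "\<epsilon> > 0" and dom: "minkowski_domain \<Omega>" and cc: "causally_convex \<Omega>"
    and incomplete: "\<not> future_complete \<Omega>" "\<not> past_complete \<Omega>"
    and fb: "stably_acausal \<epsilon> (future_causal_boundary \<Omega>)"
    and pb: "stably_acausal \<epsilon> (past_causal_boundary \<Omega>)"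
  obtains Gm Gp where "(1 / (1 + \<epsilon>))-lipschitz_on UNIV Gm" "(1 / (1 + \<epsilon>))-lipschitz_on UNIV Gp"
    "\<And>y z. y \<in> \<Omega> \<Longrightarrow> cone_le z y \<Longrightarrow> z \<in> \<Omega> \<longleftrightarrow> Gm (snd z) < fst z"
    "\<And>y z. y \<in> \<Omega> \<Longrightarrow> cone_le y z \<Longrightarrow> z \<in> \<Omega> \<longleftrightarrow> fst z < Gp (snd z)"
proof -
  have op: "open \<Omega>" and ne: "\<Omega> \<noteq> {}" using dom by (auto simp: minkowski_domain_def)
  let ?U = "snd ` \<Omega>"
  define lo where "lo p = real_of_ereal (lower_boundary \<Omega> p)" for p
  define up where "up p = real_of_ereal (upper_boundary \<Omega> p)" for p
  have lo: "lower_boundary \<Omega> p = ereal (lo p)" and up: "upper_boundary \<Omega> p = ereal (up p)" for p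
    using lower_boundary_finite[OF cc ne incomplete(2)] upper_boundary_finite[OF cc ne incomplete(1)]
    by (simp_all add: lo_def up_def ereal_real')
  note pres = graph_presentation_boundaries[OF cc op]
  have rim: "lo p = up p" if "p \<in> frontier ?U" for p
    using pres that by (auto simp: graph_presentation_def lo up)
  have slab: "x \<in> \<Omega> \<longleftrightarrow> snd x \<in> ?U \<and> lo (snd x) < fst x \<and> fst x < up (snd x)" for x
    using arg_cong[where f = "\<lambda>A. x \<in> A", OF conjunct2[OF conjunct2[OF conjunct2[OF conjunct2[OF conjunct2[OF pres[unfolded graph_presentation_def]]]]]]]
    by (simp add: case_prod_beta lo up)
  have one: "1-lipschitz_on A lo" "1-lipschitz_on A up" for A
  proof -
    have "lo p \<le> lo q + dist p q" "up p \<le> up q + dist p q" for p q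
      using lower_boundary_lipschitz[of UNIV \<Omega>] upper_boundary_lipschitz[of UNIV \<Omega>]
      by (simp_all add: ext_one_lipschitz_on_def lo up)
    then show "1-lipschitz_on A lo" "1-lipschitz_on A up"
      by (auto intro!: lipschitz_onI simp: dist_real_def abs_le_iff) (metis add.commute diff_le_eq dist_commute)+
  qed
  have "(lo p, p) \<in> past_causal_boundary \<Omega>" "(up p, p) \<in> future_causal_boundary \<Omega>"
    if "p \<in> closure ?U" for p
    unfolding past_causal_boundary_def future_causal_boundary_def
    using pres that lo up by force+
  then have lip: "(1 / (1 + \<epsilon>))-lipschitz_on (closure ?U) lo" "(1 / (1 + \<epsilon>))-lipschitz_on (closure ?U) up"
    using \<epsilon> stably_acausal_slope[OF pb \<epsilon>] stably_acausal_slope[OF fb \<epsilon>]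
    by (force intro!: lipschitz_onI simp: dist_real_def)+
  have "closure ?U \<noteq> {}" using ne by simp
  obtain Gm where Gm: "(1 / (1 + \<epsilon>))-lipschitz_on UNIV Gm" "\<And>p. p \<in> closure ?U \<Longrightarrow> Gm p = lo p"
    using mcshane_extension[OF lip(1) \<open>closure ?U \<noteq> {}\<close>] by metis
  obtain Gp where Gp: "(1 / (1 + \<epsilon>))-lipschitz_on UNIV Gp" "\<And>p. p \<in> closure ?U \<Longrightarrow> Gp p = up p"
    using mcshane_extension[OF lip(2) \<open>closure ?U \<noteq> {}\<close>] by metis
  have L1: "1 / (1 + \<epsilon>) \<le> 1" using \<epsilon> by simp
  have cl: "p \<in> closure ?U" if "p \<in> ?U" for p by (rule subsetD[OF closure_subset that])
  have fr: "p \<in> closure ?U" if "p \<in> frontier ?U" for p using that by (simp add: frontier_def)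
  show ?thesis
  proof (rule that[OF Gm(1) Gp(1)])
    fix y z assume y: "y \<in> \<Omega>" and zy: "cone_le z y"
    have yU: "snd y \<in> ?U" "fst y < up (snd y)" using y slab[of y] by blast+
    show "z \<in> \<Omega> \<longleftrightarrow> Gm (snd z) < fst z"
    proof
      assume *: "Gm (snd z) < fst z"
      have zU: "snd z \<in> ?U"
        by (rule cone_le_stays_over[OF one(2) Gm(1) L1 _ yU _ *])
          (use rim Gm(2) fr zy in \<open>simp_all add: cone_le_dist dist_commute\<close>)
      then have "lower_boundary \<Omega> (snd z) < ereal (fst z)"
        using * Gm(2)[OF cl[OF zU]] by (simp add: lo)
      then obtain w where "w \<in> \<Omega>" "dist (snd z) (snd w) < fst z - fst w"
        unfolding lower_boundary_less_iff by blast
      then show "z \<in> \<Omega>"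
        using causally_convex_between[OF cc _ y _ zy, of w] by (metis cone_le_dist dist_commute less_imp_le)
    next
      assume "z \<in> \<Omega>"
      then have "snd z \<in> ?U" "lo (snd z) < fst z" using slab[of z] by blast+
      then show "Gm (snd z) < fst z" using Gm(2)[OF cl] by metis
    qed
  next
    fix y z assume y: "y \<in> \<Omega>" and yz: "cone_le y z"
    have yU: "snd y \<in> ?U" "lo (snd y) < fst y" using y slab[of y] by blast+
    show "z \<in> \<Omega> \<longleftrightarrow> fst z < Gp (snd z)"
    proof
      assume *: "fst z < Gp (snd z)"
      \<comment> \<open>The time-reversed instance: \<open>- lo\<close> plays the role of
        \<open>f\<close> and \<open>- Gp\<close> that of \<open>G\<close>.\<close>
      have zU: "snd z \<in> ?U"
        by (rule cone_le_stays_over[of "snd ` \<Omega>" "\<lambda>p. - lo p" "1 / (1 + \<epsilon>)" "\<lambda>p. - Gp p" "snd y" "- fst y" _ "- fst z"])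
          (use one(1) Gp(1) L1 rim Gp(2) fr yU * yz in \<open>simp_all add: cone_le_dist\<close>)
      then have "ereal (fst z) < upper_boundary \<Omega> (snd z)"
        using * Gp(2)[OF cl[OF zU]] by (simp add: up)
      then obtain w where "w \<in> \<Omega>" "dist (snd z) (snd w) < fst w - fst z"
        unfolding upper_boundary_greater_iff by blast
      then show "z \<in> \<Omega>"
        using causally_convex_between[OF cc y _ yz, of w]
        by (metis cone_le_dist less_imp_le)
    next
      assume "z \<in> \<Omega>"
      then have "snd z \<in> ?U" "fst z < up (snd z)" using slab[of z] by blast+
      then show "fst z < Gp (snd z)" using Gp(2)[OF cl] by metis
    qed
  qed
qed

section \<open>Cosmological time above the graph of a Lipschitz function\<close>

definition lray :: "real ^ 'n::finite \<Rightarrow> real \<Rightarrow> 'n minkowski" where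
  "lray u s = (s, s *\<^sub>R u)"

lemma fst_lray [simp]: "fst (lray u s) = s" and snd_lray [simp]: "snd (lray u s) = s *\<^sub>R u"
  by (simp_all add: lray_def)

lemma lray_add: "lray u (s + t) = lray u s + lray u t"
  by (simp add: lray_def scaleR_add_left)

lemma lray_0 [simp]: "lray u 0 = 0"
  by (simp add: lray_def zero_prod_def)

lemma cone_le_lray:
  assumes "norm u = 1" "s \<le> t"
  shows "cone_le (x + lray u s) (x + lray u t)"
  using assms by (simp add: cone_le_def flip: scaleR_diff_left)

text \<open>Minus the metric on \<open>x - z\<close>, without the absolute value of
  \<open>time_sep\<close>: the sign tells timelike from spacelike, and the expression stays
  polynomial along rays.\<close>

definition sq_sep :: "'n::finite minkowski \<Rightarrow> 'n minkowski \<Rightarrow> real" where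
  "sq_sep x z = (fst x - fst z)\<^sup>2 - (dist (snd x) (snd z))\<^sup>2"

lemma sq_sep_same [simp]: "sq_sep x x = 0"
  by (simp add: sq_sep_def)

lemma time_sep_sq_sep: "time_sep x z = sqrt \<bar>sq_sep x z\<bar>"
  by (simp add: time_sep_def mink_self sq_sep_def dist_norm norm_minus_commute power2_commute abs_minus_commute)

lemma sq_sep_nonneg: "cone_le z x \<Longrightarrow> 0 \<le> sq_sep x z"
  by (simp add: sq_sep_def cone_le_dist dist_commute power_mono)

text \<open>The terms in \<open>s\<^sup>2\<close> from time and space cancel because
  \<open>u\<close> is a unit vector.\<close>

lemma sq_sep_lray:
  assumes "norm u = 1"
  shows "sq_sep (x + lray u s) z = sq_sep x z + 2 * s * (fst x - fst z - (snd x - snd z) \<bullet> u)"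
proof -
  define b where "b = snd x - snd z"
  define c where "c = fst x - fst z"
  have "(norm (b + s *\<^sub>R u))\<^sup>2 = (norm b)\<^sup>2 + 2 * s * (b \<bullet> u) + s\<^sup>2"
    using assms unfolding power2_norm_eq_inner norm_eq_1
    by (simp add: inner_add_left inner_add_right inner_commute power2_eq_square)
  moreover have "sq_sep (x + lray u s) z = (c + s)\<^sup>2 - (norm (b + s *\<^sub>R u))\<^sup>2"
    by (simp add: sq_sep_def dist_norm b_def c_def algebra_simps)
  moreover have "sq_sep x z = c\<^sup>2 - (norm b)\<^sup>2"
    by (simp add: sq_sep_def dist_norm b_def c_def)
  ultimately have "sq_sep (x + lray u s) z = sq_sep x z + 2 * s * (c - b \<bullet> u)"
    by (simp add: power2_eq_square algebra_simps)
  then show ?thesis by (simp only: b_def c_def)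
qed

text \<open>Going back along a null ray, the separation from \<open>z\<close> vanishes before \<open>z\<close> is passed.\<close>

lemma cone_le_null_back:
  assumes u: "norm u = 1" and s: "0 \<le> s" and z: "cone_le z x" and pos: "0 < sq_sep (x + lray u (- s)) z"
  shows "cone_le z (x + lray u (- s))"
proof -
  let ?b = "snd x - snd z" and ?a = "fst x - fst z"
  have "(norm (?b - s *\<^sub>R u))\<^sup>2 < (?a - s)\<^sup>2"
    using pos by (simp add: sq_sep_def dist_norm algebra_simps)
  then have lt: "norm (?b - s *\<^sub>R u) < \<bar>?a - s\<bar>"
    using power2_less_imp_less[of "norm (?b - s *\<^sub>R u)" "\<bar>?a - s\<bar>"] by simp
  \<comment> \<open>Excludes the past cone of \<open>z\<close>: there
    \<open>norm (?b - s *\<^sub>R u) < s - ?a\<close>, which contradicts this bound together with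
    \<open>norm ?b \<le> ?a\<close>.\<close>
  have "s \<le> norm ?b + norm (?b - s *\<^sub>R u)"
    using norm_triangle_ineq4[of ?b "?b - s *\<^sub>R u"] u s by simp
  moreover have "norm ?b \<le> ?a" using z by (simp add: cone_le_def)
  ultimately have "norm (?b - s *\<^sub>R u) \<le> ?a - s" using lt by linarith
  then show ?thesis by (simp add: cone_le_def algebra_simps)
qed

definition epi_past :: "(real ^ 'n::finite \<Rightarrow> real) \<Rightarrow> 'n minkowski \<Rightarrow> 'n minkowski set" where
  "epi_past G x = {z. cone_le z x \<and> G (snd z) < fst z}"

definition epi_tau :: "(real ^ 'n::finite \<Rightarrow> real) \<Rightarrow> 'n minkowski \<Rightarrow> real" where
  "epi_tau G x = (SUP z\<in>epi_past G x. time_sep x z)"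

locale lipschitz_epigraph =
  fixes G :: "real ^ 'n::finite \<Rightarrow> real" and L :: real
  assumes lip: "L-lipschitz_on UNIV G" and L1: "L < 1"
begin

lemma L0: "0 \<le> L"
  using lip by (rule lipschitz_on_nonneg)

lemma G_le: "G p \<le> G q + L * dist p q"
  using lipschitz_onD[OF lip, of p q] by (simp add: dist_real_def abs_le_iff)

lemma G_le_1: "G p \<le> G q + dist p q"
  using G_le[of p q] mult_right_mono[of L 1 "dist p q"] L1 by simp

lemma above_up: "cone_le z x \<Longrightarrow> G (snd z) < fst z \<Longrightarrow> G (snd x) < fst x"
  using G_le_1[of "snd x" "snd z"] by (simp add: cone_le_dist dist_commute)

lemma epi_past_self: "G (snd x) < fst x \<Longrightarrow> x \<in> epi_past G x"
  by (simp add: epi_past_def)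

text \<open>On a causal descent the graph sinks at rate at most \<open>L\<close>, so the clearance
  above it is used up at rate at least \<open>1 - L\<close>. This makes the supremum in
  \<open>epi_tau\<close> finite.\<close>

lemma epi_past_height:
  assumes "z \<in> epi_past G x"
  shows "(fst x - fst z) * (1 - L) \<le> fst x - G (snd x)"
proof -
  have z: "dist (snd x) (snd z) \<le> fst x - fst z" "G (snd z) < fst z"
    using assms by (simp_all add: epi_past_def cone_le_dist dist_commute)
  have "G (snd x) \<le> G (snd z) + L * (fst x - fst z)"
    using G_le[of "snd x" "snd z"] mult_left_mono[OF z(1) L0] by linarith
  with z(2) show ?thesis by (simp add: algebra_simps)
qed

lemma epi_past_bdd: "bdd_above (time_sep x ` epi_past G x)"
proof (rule bdd_aboveI2)
  fix z assume z: "z \<in> epi_past G x"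
  then have c: "cone_le z x" by (simp add: epi_past_def)
  then have t: "0 \<le> fst x - fst z"
    using zero_le_dist[of "snd z" "snd x"] unfolding cone_le_dist by linarith
  have "time_sep x z \<le> sqrt ((fst x - fst z)\<^sup>2)"
    unfolding time_sep_sq_sep using sq_sep_nonneg[OF c]
    by (intro real_sqrt_le_mono) (simp add: sq_sep_def)
  also have "\<dots> = fst x - fst z" using t by simp
  also have "\<dots> \<le> (fst x - G (snd x)) / (1 - L)"
    using epi_past_height[OF z] L1 by (simp add: field_simps)
  finally show "time_sep x z \<le> (fst x - G (snd x)) / (1 - L)" .
qed

lemma epi_tau_upper:
  assumes "z \<in> epi_past G x"
  shows "sq_sep x z \<le> (epi_tau G x)\<^sup>2" "0 \<le> epi_tau G x"
proof -
  have le: "time_sep x z \<le> epi_tau G x"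
    unfolding epi_tau_def by (rule cSUP_upper[OF assms epi_past_bdd])
  moreover have nn: "0 \<le> time_sep x z" by (simp add: time_sep_sq_sep)
  ultimately show "0 \<le> epi_tau G x" by linarith
  have "sq_sep x z \<le> (time_sep x z)\<^sup>2" by (simp add: time_sep_sq_sep)
  also have "\<dots> \<le> (epi_tau G x)\<^sup>2" using le nn by (rule power_mono)
  finally show "sq_sep x z \<le> (epi_tau G x)\<^sup>2" .
qed

lemma epi_tau_sq_least:
  assumes x: "G (snd x) < fst x" and le: "\<And>z. z \<in> epi_past G x \<Longrightarrow> sq_sep x z \<le> C"
  shows "(epi_tau G x)\<^sup>2 \<le> C"
proof -
  have C: "0 \<le> C" using le[OF epi_past_self[OF x]] by simp
  have "epi_tau G x \<le> sqrt C"
    unfolding epi_tau_def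
  proof (rule cSUP_least)
    fix z assume z: "z \<in> epi_past G x"
    then have "0 \<le> sq_sep x z" by (intro sq_sep_nonneg) (simp add: epi_past_def)
    then show "time_sep x z \<le> sqrt C" using le[OF z] by (simp add: time_sep_sq_sep)
  qed (use epi_past_self[OF x] in blast)
  then have "(epi_tau G x)\<^sup>2 \<le> (sqrt C)\<^sup>2"
    using epi_tau_upper(2)[OF epi_past_self[OF x]] by (rule power_mono)
  then show ?thesis using C by simp
qed

section \<open>Positivity of the cosmological time and its growth along null rays\<close>

lemma epi_tau_pos:
  assumes x: "G (snd x) < fst x"
  shows "0 < epi_tau G x"
proof -
  let ?h = "(fst x - G (snd x)) / 2"
  have "(fst x - ?h, snd x) \<in> epi_past G x"
    using x by (simp add: epi_past_def cone_le_def field_simps)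
  from epi_tau_upper[OF this] have "?h\<^sup>2 \<le> (epi_tau G x)\<^sup>2" "0 \<le> epi_tau G x"
    by (simp_all add: sq_sep_def)
  then have "?h \<le> epi_tau G x" by (rule power2_le_imp_le)
  then show ?thesis using x by simp
qed

text \<open>For fixed \<open>z\<close> the separation is affine in the ray parameter and not
  positive at the exit parameter \<open>- a\<close>; from 0 to \<open>s\<close> it therefore grows
  at least by the factor \<open>1 + s / a\<close>, which does not depend on
  \<open>z\<close>.\<close>

lemma epi_tau_null_growth:
  assumes x: "G (snd x) < fst x" and u: "norm u = 1" and s: "0 \<le> s" and a: "0 < a"
    and e: "\<not> G (snd (x + lray u (- a))) < fst (x + lray u (- a))"
  shows "(epi_tau G x)\<^sup>2 * (1 + s / a) \<le> (epi_tau G (x + lray u s))\<^sup>2"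
proof -
  have "sq_sep x z \<le> (epi_tau G (x + lray u s))\<^sup>2 / (1 + s / a)" if z: "z \<in> epi_past G x" for z
  proof -
    have zx: "cone_le z x" and zG: "G (snd z) < fst z" using z by (simp_all add: epi_past_def)
    define k where "k = fst x - fst z - (snd x - snd z) \<bullet> u"
    have sh: "sq_sep (x + lray u t) z = sq_sep x z + 2 * t * k" for t
      unfolding k_def by (rule sq_sep_lray[OF u])
    \<comment> \<open>Otherwise \<open>cone_le_null_back\<close> puts the exit point into the future
      of \<open>z\<close>, hence above the graph, against \<open>e\<close>.\<close>
    have "sq_sep (x + lray u (- a)) z \<le> 0"
      using cone_le_null_back[OF u _ zx, of a] a above_up[OF _ zG, of "x + lray u (- a)"] e by fastforce
    then have "sq_sep x z \<le> 2 * a * k" using sh[of "- a"] by simp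
    then have "sq_sep x z / a \<le> 2 * k" using a by (simp add: field_simps)
    then have "s * (sq_sep x z / a) \<le> s * (2 * k)" using s by (rule mult_left_mono)
    then have "sq_sep x z * (1 + s / a) \<le> sq_sep (x + lray u s) z"
      using sh[of s] by (simp add: algebra_simps)
    also have "\<dots> \<le> (epi_tau G (x + lray u s))\<^sup>2"
      using cone_le_trans[OF zx, of "x + lray u s"] cone_le_lray[OF u s, of x] zG
      by (intro epi_tau_upper) (simp add: epi_past_def)
    finally show ?thesis using s a by (simp add: pos_le_divide_eq add_pos_nonneg)
  qed
  then have "(epi_tau G x)\<^sup>2 \<le> (epi_tau G (x + lray u s))\<^sup>2 / (1 + s / a)"
    by (rule epi_tau_sq_least[OF x])
  then show ?thesis using s a by (simp add: pos_le_divide_eq add_pos_nonneg)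
qed

text \<open>The clearance \<open>f\<close> increases along the ray at rate at least
  \<open>1 - L\<close>, so it has a zero no further back than \<open>f 0 / (1 - L)\<close>, and it
  is positive beyond that zero.\<close>

lemma null_exit:
  assumes x: "G (snd x) < fst x" and u: "norm u = 1"
  obtains a where "0 < a" "\<not> G (snd (x + lray u (- a))) < fst (x + lray u (- a))"
    "\<And>s. - a < s \<Longrightarrow> G (snd (x + lray u s)) < fst (x + lray u s)"
proof -
  define f where "f s = fst x + s - G (snd x + s *\<^sub>R u)" for s
  have mono: "(1 - L) * (t - s) \<le> f t - f s" if "s \<le> t" for s t
    using G_le[of "snd x + t *\<^sub>R u" "snd x + s *\<^sub>R u"] that u
    by (simp add: f_def dist_norm algebra_simps flip: scaleR_diff_left)
  have cont: "continuous_on UNIV f"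
    unfolding f_def
    by (intro continuous_intros continuous_on_compose2[OF lipschitz_on_continuous_on[OF lip]]) auto
  have f0: "0 < f 0" using x by (simp add: f_def)
  define b where "b = f 0 / (1 - L)"
  have b: "0 \<le> b" "f (- b) \<le> 0"
    using mono[of "- b" 0] f0 L1 by (simp_all add: b_def)
  obtain r where r: "- b \<le> r" "r \<le> 0" "f r = 0"
    using IVT'[of f "- b" 0 0] b f0 continuous_on_subset[OF cont] by auto
  have "r \<noteq> 0" using r(3) f0 by auto
  show ?thesis
  proof (rule that[of "- r"])
    show "0 < - r" using r(2) \<open>r \<noteq> 0\<close> by simp
    show "\<not> G (snd (x + lray u (- (- r)))) < fst (x + lray u (- (- r)))" using r(3) by (simp add: f_def)
    fix s assume "- (- r) < s"
    then have "0 < (1 - L) * (s - r)" "r \<le> s" using L1 by simp_all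
    then have "0 < f s" using mono[of r s] r(3) by linarith
    then show "G (snd (x + lray u s)) < fst (x + lray u s)" by (simp add: f_def)
  qed
qed

text \<open>\<open>z'\<close> maximizes the separation from \<open>x\<close> among the points that the Lipschitz condition at \<open>z\<close> forces
  to lie above the graph.\<close>

lemma epi_past_steeper:
  assumes z: "z \<in> epi_past G x" and flat: "L * (fst x - fst z) \<le> dist (snd x) (snd z)"
  obtains z' where "z' \<in> epi_past G x" "dist (snd x) (snd z') = L * (fst x - fst z')"
    "fst x - fst z' = ((fst x - fst z) - L * dist (snd x) (snd z)) / (1 - L\<^sup>2)"
proof -
  define \<alpha> where "\<alpha> = fst x - fst z"
  define r where "r = dist (snd x) (snd z)"
  \<comment> \<open>The points just forced above the graph at distance r' from \<open>x\<close>
    towards \<open>z\<close> have depth \<alpha>' = \<alpha> - L (r - r'). On this line \<alpha>'^2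
    - r'^2 is stationary for r' = L \<alpha>', which gives the quotient.\<close>
  define \<alpha>' where "\<alpha>' = (\<alpha> - L * r) / (1 - L\<^sup>2)"
  have L2: "0 < 1 - L\<^sup>2" using L0 L1 by (simp add: power_less_one_iff abs_square_less_1)
  have \<alpha>'_eq: "\<alpha> - L * r = \<alpha>' - L\<^sup>2 * \<alpha>'" proof -
    have "\<alpha>' * (1 - L\<^sup>2) = \<alpha> - L * r" using L2 by (simp add: \<alpha>'_def)
    then show ?thesis by (simp add: algebra_simps)
  qed
  have r: "0 \<le> r" "r \<le> \<alpha>" "L * \<alpha> \<le> r"
    using z flat by (simp_all add: r_def \<alpha>_def epi_past_def cone_le_dist dist_commute)
  have "L * r \<le> r" using mult_right_mono[of L 1 r] L1 r(1) by simp
  then have \<alpha>'0: "0 \<le> \<alpha>'" using r L2 by (simp add: \<alpha>'_def)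
  have "L * (\<alpha> - L * r) \<le> r * (1 - L\<^sup>2)"
    using r(3) by (simp add: algebra_simps power2_eq_square)
  then have L\<alpha>': "L * \<alpha>' \<le> r" using L2 by (simp add: \<alpha>'_def pos_divide_le_eq)
  \<comment> \<open>For \<open>r = 0\<close> the quotient is 0 by convention, which is right since
    \<open>L * \<alpha>' \<le> r\<close> forces \<open>L * \<alpha>' = 0\<close>.\<close>
  define \<kappa> where "\<kappa> = L * \<alpha>' / r"
  have \<kappa>r: "\<kappa> * r = L * \<alpha>'" using L\<alpha>' mult_nonneg_nonneg[OF L0 \<alpha>'0] by (cases "r = 0") (simp_all add: \<kappa>_def)
  have \<kappa>: "0 \<le> \<kappa>" "\<kappa> \<le> 1" using L\<alpha>' L0 \<alpha>'0 r(1) by (auto simp: \<kappa>_def divide_le_eq_1)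
  define z' where "z' = (fst x - \<alpha>', snd x - \<kappa> *\<^sub>R (snd x - snd z))"
  have d1: "dist (snd x) (snd z') = L * \<alpha>'"
    using \<kappa>(1) \<kappa>r by (simp add: z'_def dist_norm r_def)
  have dir: "snd z' - snd z = (1 - \<kappa>) *\<^sub>R (snd x - snd z)"
    by (simp add: z'_def algebra_simps)
  have "dist (snd z') (snd z) = (1 - \<kappa>) * r"
    unfolding dist_norm dir r_def using \<kappa>(2) by simp
  then have d2: "dist (snd z') (snd z) = r - L * \<alpha>'"
    using \<kappa>r by (simp add: left_diff_distrib)
  have "L * \<alpha>' \<le> \<alpha>'" using mult_right_mono[of L 1 \<alpha>'] L1 \<alpha>'0 by simp
  then have "cone_le z' x" using d1 by (simp add: cone_le_dist dist_commute) (simp add: z'_def)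
  moreover have "G (snd z') < fst z'"
  proof -
    have "G (snd z') \<le> G (snd z) + (L * r - L\<^sup>2 * \<alpha>')"
      using G_le[of "snd z'" "snd z"] unfolding d2 by (simp add: algebra_simps power2_eq_square)
    also have "\<dots> < fst z + (L * r - L\<^sup>2 * \<alpha>')" using z by (simp add: epi_past_def)
    also have "\<dots> = fst z'" using \<alpha>'_eq by (simp add: z'_def \<alpha>_def)
    finally show ?thesis .
  qed
  ultimately have "z' \<in> epi_past G x" by (simp add: epi_past_def)
  moreover have "fst x - fst z' = \<alpha>'" by (simp add: z'_def)
  ultimately show ?thesis using that d1 by (simp add: \<alpha>'_def \<alpha>_def r_def)
qed

text \<open>The largest value of (\<alpha> + r) / (\<alpha> - r) under the slope condition r \<le> L
  \<alpha>.\<close>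

definition M :: real where "M = (1 + L) / (1 - L)"

lemma M_pos: "0 < M"
  using L0 L1 by (simp add: M_def)

text \<open>The null vector itself has separation 0. \<open>epi_past_steeper\<close> tilts it to
  slope \<open>L\<close> at depth \<open>a / (1 + L)\<close>, where the separation is
  \<open>(1 - L\<^sup>2) * (a / (1 + L))\<^sup>2 = a\<^sup>2 / M\<close>.\<close>

lemma null_length_le_tau:
  assumes u: "norm u = 1" and a: "0 \<le> a" and e: "G (snd (y + lray u (- a))) < fst (y + lray u (- a))"
  shows "a\<^sup>2 \<le> M * (epi_tau G y)\<^sup>2"
proof -
  let ?e = "y + lray u (- a)"
  have d: "dist (snd y) (snd ?e) = a" using u a by (simp add: dist_norm)
  have "?e \<in> epi_past G y"
    using cone_le_lray[OF u, of "- a" 0 y] a e by (simp add: epi_past_def)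
  moreover have "L * (fst y - fst ?e) \<le> dist (snd y) (snd ?e)"
    unfolding d using mult_right_mono[of L 1 a] L1 a by simp
  ultimately obtain z where z: "z \<in> epi_past G y" "dist (snd y) (snd z) = L * (fst y - fst z)"
    "fst y - fst z = ((fst y - fst ?e) - L * dist (snd y) (snd ?e)) / (1 - L\<^sup>2)"
    by (rule epi_past_steeper)
  have fac: "1 - L\<^sup>2 = (1 - L) * (1 + L)" by (simp add: power2_eq_square algebra_simps)
  have "fst y - fst z = (a * (1 - L)) / (1 - L\<^sup>2)"
    unfolding z(3) d by (simp add: algebra_simps)
  also have "\<dots> = a / (1 + L)" using L0 L1 by (simp add: fac)
  finally have t: "fst y - fst z = a / (1 + L)" .
  have "sq_sep y z = (1 - L\<^sup>2) * (a / (1 + L))\<^sup>2"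
    unfolding sq_sep_def z(2) t power_mult_distrib by (simp only: left_diff_distrib mult_1_left)
  then have "M * sq_sep y z = a\<^sup>2"
    using L0 L1 by (simp add: M_def fac power_divide) (simp add: power2_eq_square)
  then show ?thesis
    using mult_left_mono[OF epi_tau_upper(1)[OF z(1)], of M] M_pos by simp
qed

lemma epi_past_le_steep:
  assumes "\<And>z. z \<in> epi_past G x \<Longrightarrow> dist (snd x) (snd z) \<le> L * (fst x - fst z) \<Longrightarrow> sq_sep x z \<le> C"
    and z: "z \<in> epi_past G x"
  shows "sq_sep x z \<le> C"
proof (cases "dist (snd x) (snd z) \<le> L * (fst x - fst z)")
  case False
  let ?\<alpha> = "fst x - fst z" and ?r = "dist (snd x) (snd z)"
  from False obtain z' where z': "z' \<in> epi_past G x" "dist (snd x) (snd z') = L * (fst x - fst z')"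
    "fst x - fst z' = (?\<alpha> - L * ?r) / (1 - L\<^sup>2)"
    using epi_past_steeper[OF z] by (metis linear)
  have L2: "0 < 1 - L\<^sup>2" using L0 L1 by (simp add: power_less_one_iff abs_square_less_1)
  \<comment> \<open>The difference of the two sides is the square
    \<open>(L * ?\<alpha> - ?r)\<^sup>2\<close>; after division by \<open>1 - L\<^sup>2\<close> the
    right side is the separation of \<open>z'\<close>.\<close>
  have "(?\<alpha>\<^sup>2 - ?r\<^sup>2) * (1 - L\<^sup>2) \<le> (?\<alpha> - L * ?r)\<^sup>2"
    using zero_le_power2[of "L * ?\<alpha> - ?r"] by (simp add: power2_eq_square algebra_simps)
  then have "sq_sep x z \<le> (?\<alpha> - L * ?r)\<^sup>2 / (1 - L\<^sup>2)"
    using L2 by (simp add: sq_sep_def pos_le_divide_eq)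
  also have "\<dots> = (1 - L\<^sup>2) * (fst x - fst z')\<^sup>2"
    unfolding z'(3) using L2 by (simp add: power2_eq_square)
  also have "\<dots> = sq_sep x z'"
    unfolding sq_sep_def z'(2) power_mult_distrib by (simp only: left_diff_distrib mult_1_left)
  also have "\<dots> \<le> C" using assms(1)[OF z'(1)] z'(2) by simp
  finally show ?thesis .
qed (use assms in blast)

text \<open>A competitor loses at most 2 s (\<alpha> + r) over the step. The bound on (\<alpha> +
  r)^2 from the slope and the bound on a^2 from \<open>null_length_le_tau\<close> are multiplied,
  and the root of the product controls (\<alpha> + r) a.\<close>

lemma epi_tau_null_step:
  assumes u: "norm u = 1" and s: "0 \<le> s" and a: "0 < a"
    and e: "G (snd (y + lray u (- a))) < fst (y + lray u (- a))"
  shows "(epi_tau G y)\<^sup>2 \<le> (epi_tau G (y + lray u (- s)))\<^sup>2 + 2 * M * s / a * (epi_tau G y)\<^sup>2"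
proof -
  let ?x = "y + lray u (- s)" and ?T = "(epi_tau G y)\<^sup>2"
  have y: "G (snd y) < fst y"
    using above_up[OF _ e, of y] cone_le_lray[OF u, of "- a" 0 y] a by simp
  have aT: "a\<^sup>2 \<le> M * ?T" using a by (intro null_length_le_tau[OF u _ e]) simp
  show ?thesis
  proof (rule epi_tau_sq_least[OF y], erule epi_past_le_steep[rotated])
    fix z assume z: "z \<in> epi_past G y" and steep: "dist (snd y) (snd z) \<le> L * (fst y - fst z)"
    have zy: "cone_le z y" and zG: "G (snd z) < fst z" using z by (simp_all add: epi_past_def)
    define \<alpha> where "\<alpha> = fst y - fst z"
    define r where "r = dist (snd y) (snd z)"
    have r: "0 \<le> r" "r \<le> L * \<alpha>" "r \<le> \<alpha>"
      using steep zy by (simp_all add: r_def \<alpha>_def cone_le_dist dist_commute)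
    have "(1 - L) * (\<alpha> + r) \<le> (1 + L) * (\<alpha> - r)" using r(2) by (simp add: algebra_simps)
    then have "\<alpha> + r \<le> M * (\<alpha> - r)" using L1 by (simp add: M_def field_simps)
    then have "(\<alpha> + r) * (\<alpha> + r) \<le> M * (\<alpha> - r) * (\<alpha> + r)"
      using r by (intro mult_right_mono) simp_all
    also have "\<dots> = M * sq_sep y z"
      by (simp add: sq_sep_def \<alpha>_def r_def power2_eq_square algebra_simps)
    also have "\<dots> \<le> M * ?T" using epi_tau_upper(1)[OF z] M_pos by simp
    finally have "(\<alpha> + r)\<^sup>2 \<le> M * ?T" by (simp add: power2_eq_square)
    then have "(\<alpha> + r)\<^sup>2 * a\<^sup>2 \<le> (M * ?T) * (M * ?T)"
      using aT M_pos by (intro mult_mono) simp_all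
    then have "((\<alpha> + r) * a)\<^sup>2 \<le> (M * ?T)\<^sup>2" by (simp add: power2_eq_square algebra_simps)
    then have "(\<alpha> + r) * a \<le> M * ?T" by (rule power2_le_imp_le) (use M_pos in simp)
    then have "\<alpha> + r \<le> M * ?T / a" using a by (simp add: pos_le_divide_eq)
    moreover have "- ((snd y - snd z) \<bullet> u) \<le> r"
      using norm_cauchy_schwarz[of "snd z - snd y" u] u
      by (simp add: r_def dist_norm inner_diff_left norm_minus_commute)
    ultimately have "2 * s * (\<alpha> - (snd y - snd z) \<bullet> u) \<le> 2 * s * (M * ?T / a)"
      using s by (intro mult_left_mono) simp_all
    then have le: "sq_sep y z \<le> sq_sep ?x z + 2 * M * s / a * ?T"
      using sq_sep_lray[OF u, of y "- s" z] by (simp add: \<alpha>_def algebra_simps)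
    show "sq_sep y z \<le> (epi_tau G ?x)\<^sup>2 + 2 * M * s / a * ?T"
    proof (cases "0 < sq_sep ?x z")
      case True
      then have "z \<in> epi_past G ?x"
        using cone_le_null_back[OF u s zy] zG by (simp add: epi_past_def)
      then show ?thesis using epi_tau_upper(1) le by fastforce
    next
      \<comment> \<open>Here \<open>z\<close> need not lie in the past of \<open>?x\<close>, but its
        contribution there is not positive, so any square bounds it.\<close>
      case False
      then show ?thesis using le zero_le_power2[of "epi_tau G ?x"] by linarith
    qed
  qed
qed

text \<open>Vanishing steps would give the factor \<open>M\<close>; \<open>2 * M\<close> absorbs the error of a small finite step.\<close>

lemma ln_epi_tau_null_small:
  assumes u: "norm u = 1" and e: "G (snd e) < fst e" and s: "0 < s" "s \<le> t" "4 * M * (t - s) \<le> t"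
  shows "ln (epi_tau G (e + lray u t)) - ln (epi_tau G (e + lray u s)) \<le> 2 * M * (ln t - ln s)"
proof -
  define x where "x = e + lray u s"
  define y where "y = e + lray u t"
  define q where "q = 2 * M * (t - s) / t"
  have "0 < t" using s by linarith
  have yx: "y + lray u (- (t - s)) = x" "y + lray u (- t) = e"
    by (simp_all add: x_def y_def add.assoc flip: lray_add)
  have "cone_le e x" "cone_le e y"
    using cone_le_lray[OF u, of 0 s e] cone_le_lray[OF u, of 0 t e] s \<open>0 < t\<close>
    by (simp_all add: x_def y_def)
  then have "G (snd x) < fst x" "G (snd y) < fst y"
    using above_up e by blast+
  then have pos: "0 < epi_tau G x" "0 < epi_tau G y" by (simp_all add: epi_tau_pos)
  have q: "0 \<le> q" "q \<le> 1 / 2" using s M_pos \<open>0 < t\<close> by (simp_all add: q_def field_simps)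
  have "(epi_tau G y)\<^sup>2 \<le> (epi_tau G x)\<^sup>2 + q * (epi_tau G y)\<^sup>2"
    using epi_tau_null_step[OF u, of "t - s" t y] e s \<open>0 < t\<close> unfolding yx q_def by simp
  then have "1 - q \<le> (epi_tau G x / epi_tau G y)\<^sup>2"
    using pos by (simp add: power_divide field_simps)
  then have "ln (1 - q) \<le> ln ((epi_tau G x / epi_tau G y)\<^sup>2)"
    using q pos by (subst ln_le_cancel_iff) auto
  also have "\<dots> = 2 * (ln (epi_tau G x) - ln (epi_tau G y))"
    using pos by (simp add: ln_realpow ln_div)
  finally have "2 * (ln (epi_tau G y) - ln (epi_tau G x)) \<le> - ln (1 - q)" by simp
  \<comment> \<open>The factor two is lost here: to first order the value is \<open>q\<close>, and
    \<open>q \<le> 1 / 2\<close> only gives \<open>2 * q\<close>.\<close>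
  also have "\<dots> \<le> q + 2 * q\<^sup>2"
    using ln_one_minus_pos_lower_bound[OF q] by simp
  also have "\<dots> \<le> 2 * q"
    using mult_left_mono[OF q(2) q(1)] by (simp add: power2_eq_square)
  also have "\<dots> = 4 * M * (1 - s / t)" using \<open>0 < t\<close> by (simp add: q_def field_simps)
  also have "\<dots> \<le> 4 * M * (ln t - ln s)"
  proof -
    have "ln (s / t) \<le> s / t - 1" using s \<open>0 < t\<close> by (intro ln_le_minus_one) simp
    then show ?thesis using s \<open>0 < t\<close> M_pos by (intro mult_left_mono) (simp_all add: ln_div)
  qed
  finally show ?thesis by (simp add: x_def y_def)
qed

text \<open>The interval is cut into \<open>N\<close> equal steps \<delta> with
  \<open>4 * M * \<delta> \<le> s\<close>. Every step starts at \<open>s\<close> or later, so the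
  small-step estimate applies to each, and \<phi> does not increase from step to step.\<close>

lemma ln_epi_tau_null_le:
  assumes u: "norm u = 1" and e: "G (snd e) < fst e" and s: "0 < s" "s \<le> t"
  shows "ln (epi_tau G (e + lray u t)) - ln (epi_tau G (e + lray u s)) \<le> 2 * M * (ln t - ln s)"
proof -
  define \<phi> where "\<phi> r = ln (epi_tau G (e + lray u r)) - 2 * M * ln r" for r
  obtain N :: nat where N: "4 * M * (t - s) / s < real N" using reals_Archimedean2 by blast
  have "0 \<le> 4 * M * (t - s) / s" using s M_pos by simp
  then have N0: "0 < real N" using N by linarith
  define \<delta> where "\<delta> = (t - s) / real N"
  have \<delta>: "0 \<le> \<delta>" "4 * M * \<delta> \<le> s"
    using N N0 s by (simp_all add: \<delta>_def field_simps)
  have "\<phi> (s + real k * \<delta>) \<le> \<phi> s" for k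
  proof (induction k)
    case (Suc k)
    let ?r = "s + real k * \<delta>"
    have "0 < ?r" using s \<delta> by (intro add_pos_nonneg) simp_all
    moreover have "4 * M * ((?r + \<delta>) - ?r) \<le> ?r + \<delta>"
    proof -
      have "s \<le> ?r + \<delta>" using \<delta>(1) by simp
      then show ?thesis using \<delta>(2) by simp
    qed
    ultimately have "\<phi> (?r + \<delta>) \<le> \<phi> ?r"
      using ln_epi_tau_null_small[OF u e, of ?r "?r + \<delta>"] \<delta>(1) by (simp add: \<phi>_def algebra_simps)
    moreover have "s + real (Suc k) * \<delta> = ?r + \<delta>" by (simp add: algebra_simps)
    ultimately show ?case using Suc by (metis order_trans)
  qed simp
  from this[of N] have "\<phi> t \<le> \<phi> s" using N0 by (simp add: \<delta>_def)
  then show ?thesis by (simp add: \<phi>_def algebra_simps)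
qed

end

section \<open>Cross ratios and chains\<close>

text \<open>The Hilbert distance of \<open>s\<close> and \<open>t\<close> in the interval with ends
  \<alpha> and \<beta>, in either order of the ends.\<close>

definition cross_log :: "real \<Rightarrow> real \<Rightarrow> real \<Rightarrow> real \<Rightarrow> real" where
  "cross_log \<alpha> \<beta> s t = \<bar>ln (((s - \<beta>) * (t - \<alpha>)) / ((s - \<alpha>) * (t - \<beta>)))\<bar>"

lemma rho_I_cross_log: "rho_I s t = cross_log (-1) 1 s t"
  by (simp add: rho_I_def cross_log_def)

lemma abs_ln_divide_commute: "\<bar>ln (a / b)\<bar> = \<bar>ln (b / a :: real)\<bar>"
  using ln_inverse[of "a / b"] by (simp add: inverse_eq_divide)

lemma cross_log_commute: "cross_log \<alpha> \<beta> s t = cross_log \<alpha> \<beta> t s"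
  unfolding cross_log_def by (subst abs_ln_divide_commute) (simp add: mult.commute)

lemma cross_log_commute_ends: "cross_log \<alpha> \<beta> s t = cross_log \<beta> \<alpha> s t"
  unfolding cross_log_def by (subst abs_ln_divide_commute) simp

text \<open>Separates the two ends of the interval, so that each can be matched with one
  cosmological time.\<close>

lemma cross_log_less:
  assumes "\<alpha> < s" "s \<le> t" "t < \<beta>"
  shows "cross_log \<alpha> \<beta> s t = (ln (t - \<alpha>) - ln (s - \<alpha>)) + (ln (\<beta> - s) - ln (\<beta> - t))"
proof -
  have eq: "((s - \<beta>) * (t - \<alpha>)) / ((s - \<alpha>) * (t - \<beta>)) = ((t - \<alpha>) / (s - \<alpha>)) * ((\<beta> - s) / (\<beta> - t))"
    using assms by (simp add: divide_simps) (simp add: algebra_simps)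
  have "ln (s - \<alpha>) \<le> ln (t - \<alpha>)" "ln (\<beta> - t) \<le> ln (\<beta> - s)" using assms by simp_all
  moreover have "ln (((t - \<alpha>) / (s - \<alpha>)) * ((\<beta> - s) / (\<beta> - t))) =
      (ln (t - \<alpha>) - ln (s - \<alpha>)) + (ln (\<beta> - s) - ln (\<beta> - t))"
    using assms by (simp add: ln_mult ln_div)
  ultimately show ?thesis unfolding cross_log_def eq by linarith
qed

lemma cross_log_tendsto:
  assumes "s \<in> I_int" "t \<in> I_int"
  shows "((\<lambda>r. cross_log (- r) r s t) \<longlongrightarrow> rho_I s t) (at_left 1)"
proof -
  have "((\<lambda>r. ((s - r) * (t - (- r))) / ((s - (- r)) * (t - r)))
      \<longlongrightarrow> ((s - 1) * (t - (- 1))) / ((s - (- 1)) * (t - 1))) (at_left 1)"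
    using assms by (intro tendsto_intros) auto
  moreover have "((s - 1) * (t - (- 1))) / ((s - (- 1)) * (t - 1)) \<noteq> 0" using assms by auto
  ultimately show ?thesis
    unfolding rho_I_cross_log cross_log_def by (intro tendsto_rabs tendsto_ln)
qed

lemma homography_on_I_scale:
  assumes "homography_on_I h" "w \<noteq> 0"
  shows "homography_on_I (\<lambda>s. h s * w)"
proof -
  obtain a b c d where *: "a * d - b * c \<noteq> 0"
    "\<And>s. s \<in> I_int \<Longrightarrow> c * s + d \<noteq> 0 \<and> h s = (a * s + b) / (c * s + d)"
    using assms(1) unfolding homography_on_I_def by blast
  have "(a * w) * d - (b * w) * c = w * (a * d - b * c)" by (simp add: algebra_simps)
  then have "(a * w) * d - (b * w) * c \<noteq> 0" using * assms(2) by simp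
  moreover have "c * s + d \<noteq> 0 \<and> h s * w = ((a * w) * s + b * w) / (c * s + d)" if "s \<in> I_int" for s
    using *(2)[OF that] by (simp add: algebra_simps)
  ultimately show ?thesis unfolding homography_on_I_def by blast
qed

text \<open>\<open>D\<close> is the determinant and \<open>E\<close> the denominator, which keeps
  its sign because a zero between \<open>p\<close> and \<open>q\<close> would be a pole in
  \<open>I_int\<close>. Invariance of cross ratios and monotonicity both follow from this
  formula.\<close>

lemma homography_on_I_diff:
  assumes "homography_on_I h"
  obtains D E where "D \<noteq> 0" "\<And>p q. p \<in> I_int \<Longrightarrow> q \<in> I_int \<Longrightarrow> 0 < E p * E q"
    "\<And>p q. p \<in> I_int \<Longrightarrow> q \<in> I_int \<Longrightarrow> h p - h q = D * (p - q) / (E p * E q)"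
proof -
  obtain a b c d where D: "a * d - b * c \<noteq> 0"
    and h: "\<And>s. s \<in> I_int \<Longrightarrow> c * s + d \<noteq> 0 \<and> h s = (a * s + b) / (c * s + d)"
    using assms(1) unfolding homography_on_I_def by blast
  show ?thesis
  proof (rule that[of "a * d - b * c" "\<lambda>s. c * s + d"])
    show "a * d - b * c \<noteq> 0" by fact
    fix p q assume pq: "p \<in> I_int" "q \<in> I_int"
    have nz: "c * p + d \<noteq> 0" "c * q + d \<noteq> 0" using h pq by blast+
    show "h p - h q = (a * d - b * c) * (p - q) / ((c * p + d) * (c * q + d))"
      unfolding conjunct2[OF h[OF pq(1)]] conjunct2[OF h[OF pq(2)]]
      using nz by (simp add: divide_simps) (simp add: algebra_simps)
    show "0 < (c * p + d) * (c * q + d)"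
    proof (rule ccontr)
      assume "\<not> ?thesis"
      then have neg: "(c * p + d) * (c * q + d) < 0" using nz by (simp add: not_less less_le)
      have "c \<noteq> 0" using neg zero_le_square[of d] by (auto simp: not_less)
      define w where "w = - d / c"
      have E: "c * s + d = c * (s - w)" for s using \<open>c \<noteq> 0\<close> by (simp add: w_def algebra_simps)
      have "c\<^sup>2 * ((p - w) * (q - w)) < 0" using neg unfolding E by (simp add: power2_eq_square algebra_simps)
      then have "(p - w) * (q - w) < 0" using \<open>c \<noteq> 0\<close> by (simp add: mult_less_0_iff)
      then have "w \<in> I_int" using pq by (auto simp: mult_less_0_iff)
      then show False using h[of w] E[of w] by simp
    qed
  qed
qed

text \<open>All factors \<open>D\<close> and \<open>E\<close> cancel in the cross ratio. The sign of
  \<open>D\<close> decides between increasing and decreasing, hence the two orders of the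
  ends.\<close>

lemma homography_on_I_cross_log:
  assumes h: "homography_on_I h" and st: "\<bar>s\<bar> < r" "\<bar>t\<bar> < r" "r < 1"
  shows "cross_log (h (- r)) (h r) (h s) (h t) = cross_log (- r) r s t"
    and "{h s, h t} \<subseteq> {h (- r)<..<h r} \<or> {h s, h t} \<subseteq> {h r<..<h (- r)}"
proof -
  obtain D E where D: "D \<noteq> 0" and E: "\<And>p q. p \<in> I_int \<Longrightarrow> q \<in> I_int \<Longrightarrow> 0 < E p * E q"
    and diff: "\<And>p q. p \<in> I_int \<Longrightarrow> q \<in> I_int \<Longrightarrow> h p - h q = D * (p - q) / (E p * E q)"
    using homography_on_I_diff[OF h] by metis
  have I: "s \<in> I_int" "t \<in> I_int" "r \<in> I_int" "- r \<in> I_int" using st by auto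
  have nz: "E p \<noteq> 0" if "p \<in> I_int" for p using E[OF that that] by auto
  have "((h s - h r) * (h t - h (- r))) / ((h s - h (- r)) * (h t - h r)) =
    ((s - r) * (t - (- r))) / ((s - (- r)) * (t - r))"
    unfolding diff[OF I(1) I(3)] diff[OF I(2) I(4)] diff[OF I(1) I(4)] diff[OF I(2) I(3)]
    using D nz[OF I(1)] nz[OF I(2)] nz[OF I(3)] nz[OF I(4)] st
    by (simp add: divide_simps)
  then show "cross_log (h (- r)) (h r) (h s) (h t) = cross_log (- r) r s t"
    by (simp only: cross_log_def)
  have mono: "h p < h q \<longleftrightarrow> 0 < D" if "p \<in> I_int" "q \<in> I_int" "p < q" for p q
  proof -
    have "h p < h q \<longleftrightarrow> 0 < D * (q - p) / (E q * E p)"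
      using diff[OF that(2,1)] by (metis diff_gt_0_iff_gt)
    then show ?thesis using E[OF that(2,1)] that(3) by (simp add: zero_less_divide_iff zero_less_mult_iff)
  qed
  have inj: "h p \<noteq> h q" if "p \<in> I_int" "q \<in> I_int" "p < q" for p q
    using diff[OF that(2,1)] D E[OF that(2,1)] that(3) by auto
  have "- r < s" "- r < t" "s < r" "t < r" using st by auto
  note rules = I(4,1) \<open>- r < s\<close> I(4,2) \<open>- r < t\<close> I(1,3) \<open>s < r\<close> I(2,3) \<open>t < r\<close>
  show "{h s, h t} \<subseteq> {h (- r)<..<h r} \<or> {h s, h t} \<subseteq> {h r<..<h (- r)}"
  proof (cases "0 < D")
    case True
    then show ?thesis
      using mono[OF rules(1-3)] mono[OF rules(4-6)] mono[OF rules(7-9)] mono[OF rules(10-12)] by simp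
  next
    case False
    then have anti: "h q < h p" if "p \<in> I_int" "q \<in> I_int" "p < q" for p q
      using mono[OF that] inj[OF that] by (metis linorder_neqE)
    show ?thesis
      using anti[OF rules(1-3)] anti[OF rules(4-6)] anti[OF rules(7-9)] anti[OF rules(10-12)] by simp
  qed
qed

section \<open>Chains of points and chains of geodesics\<close>

definition null_chain ::
    "'n::finite minkowski set \<Rightarrow> nat \<Rightarrow> (nat \<Rightarrow> 'n minkowski) \<Rightarrow> 'n minkowski \<Rightarrow> 'n minkowski \<Rightarrow> bool" where
  "null_chain \<Omega> m z x y \<longleftrightarrow>
     m \<ge> 1 \<and> z 1 = x \<and> z m = y \<and> (\<forall>k\<in>{1..m}. z k \<in> \<Omega>) \<and>
     (\<forall>k\<in>{1..<m}. causally_related mink (z k) (z (k + 1)))"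

definition null_sums ::
    "'n::finite minkowski set \<Rightarrow> ('n minkowski \<Rightarrow> real) \<Rightarrow> 'n minkowski \<Rightarrow> 'n minkowski \<Rightarrow> real set" where
  "null_sums \<Omega> T x y = {(\<Sum>k\<in>{1..<m}. \<bar>T (z (k + 1)) - T (z k)\<bar>) | m z. null_chain \<Omega> m z x y}"

lemma null_distance_eq: "null_distance \<Omega> T x y = Inf (null_sums \<Omega> T x y)"
  by (simp add: null_distance_def null_sums_def null_chain_def)

definition markowitz_chain ::
    "'n::finite minkowski set \<Rightarrow> nat \<Rightarrow> (nat \<Rightarrow> real \<Rightarrow> 'n minkowski) \<Rightarrow> (nat \<Rightarrow> real) \<Rightarrow> (nat \<Rightarrow> real) \<Rightarrow>
     'n minkowski \<Rightarrow> 'n minkowski \<Rightarrow> bool" where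
  "markowitz_chain \<Omega> m \<gamma> s t x y \<longleftrightarrow>
     m \<ge> 1 \<and>
     (\<forall>k\<in>{1..m}. proj_lightlike_geodesic \<Omega> (\<gamma> k) \<and> s k \<in> I_int \<and> t k \<in> I_int) \<and>
     \<gamma> 1 (s 1) = x \<and> \<gamma> m (t m) = y \<and>
     (\<forall>k\<in>{1..<m}. \<gamma> k (t k) = \<gamma> (k + 1) (s (k + 1)))"

definition markowitz_sums ::
    "'n::finite minkowski set \<Rightarrow> 'n minkowski \<Rightarrow> 'n minkowski \<Rightarrow> real set" where
  "markowitz_sums \<Omega> x y = {(\<Sum>k\<in>{1..m}. rho_I (s k) (t k)) | m \<gamma> s t. markowitz_chain \<Omega> m \<gamma> s t x y}"

lemma markowitz_sumsI:
  "markowitz_chain \<Omega> m \<gamma> s t x y \<Longrightarrow> (\<Sum>k\<in>{1..m}. rho_I (s k) (t k)) \<in> markowitz_sums \<Omega> x y"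
  unfolding markowitz_sums_def by blast

lemma null_sumsI:
  "null_chain \<Omega> m z x y \<Longrightarrow> (\<Sum>k\<in>{1..<m}. \<bar>T (z (k + 1)) - T (z k)\<bar>) \<in> null_sums \<Omega> T x y"
  unfolding null_sums_def by blast

lemma markowitz_eq: "markowitz \<Omega> x y = Inf (markowitz_sums \<Omega> x y)"
  by (simp add: markowitz_def markowitz_sums_def markowitz_chain_def)

lemma null_sums_nonneg: "r \<in> null_sums \<Omega> T x y \<Longrightarrow> 0 \<le> r"
  by (auto simp: null_sums_def intro!: sum_nonneg)

lemma markowitz_sums_nonneg: "r \<in> markowitz_sums \<Omega> x y \<Longrightarrow> 0 \<le> r"
  by (auto simp: markowitz_sums_def rho_I_def intro!: sum_nonneg)

lemma markowitz_sums_single: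
  assumes "proj_lightlike_geodesic \<Omega> \<gamma>" "s \<in> I_int" "t \<in> I_int"
  shows "rho_I s t \<in> markowitz_sums \<Omega> (\<gamma> s) (\<gamma> t)"
proof -
  have "markowitz_chain \<Omega> 1 (\<lambda>_. \<gamma>) (\<lambda>_. s) (\<lambda>_. t) (\<gamma> s) (\<gamma> t)"
    using assms by (simp add: markowitz_chain_def)
  from markowitz_sumsI[OF this] show ?thesis by simp
qed

lemma markowitz_sums_append:
  assumes "r1 \<in> markowitz_sums \<Omega> x y" "r2 \<in> markowitz_sums \<Omega> y z"
  shows "r1 + r2 \<in> markowitz_sums \<Omega> x z"
proof -
  obtain m1 \<gamma>1 s1 t1 where c1: "markowitz_chain \<Omega> m1 \<gamma>1 s1 t1 x y"
      and r1: "r1 = (\<Sum>k\<in>{1..m1}. rho_I (s1 k) (t1 k))"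
    using assms(1) unfolding markowitz_sums_def by blast
  have 1: "m1 \<ge> 1"
    "\<forall>k\<in>{1..m1}. proj_lightlike_geodesic \<Omega> (\<gamma>1 k) \<and> s1 k \<in> I_int \<and> t1 k \<in> I_int"
    "\<gamma>1 1 (s1 1) = x" "\<gamma>1 m1 (t1 m1) = y"
    "\<forall>k\<in>{1..<m1}. \<gamma>1 k (t1 k) = \<gamma>1 (k + 1) (s1 (k + 1))"
    using c1 by (simp_all add: markowitz_chain_def)
  obtain m2 \<gamma>2 s2 t2 where c2: "markowitz_chain \<Omega> m2 \<gamma>2 s2 t2 y z"
      and r2: "r2 = (\<Sum>k\<in>{1..m2}. rho_I (s2 k) (t2 k))"
    using assms(2) unfolding markowitz_sums_def by blast
  have 2: "m2 \<ge> 1"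
    "\<forall>k\<in>{1..m2}. proj_lightlike_geodesic \<Omega> (\<gamma>2 k) \<and> s2 k \<in> I_int \<and> t2 k \<in> I_int"
    "\<gamma>2 1 (s2 1) = y" "\<gamma>2 m2 (t2 m2) = z"
    "\<forall>k\<in>{1..<m2}. \<gamma>2 k (t2 k) = \<gamma>2 (k + 1) (s2 (k + 1))"
    using c2 by (simp_all add: markowitz_chain_def)
  define \<gamma> where "\<gamma> k = (if k \<le> m1 then \<gamma>1 k else \<gamma>2 (k - m1))" for k
  define s where "s k = (if k \<le> m1 then s1 k else s2 (k - m1))" for k
  define t where "t k = (if k \<le> m1 then t1 k else t2 (k - m1))" for k
  have "(\<Sum>k\<in>{1..m1 + m2}. rho_I (s k) (t k)) =
      (\<Sum>k\<in>{1..m1}. rho_I (s k) (t k)) + (\<Sum>k\<in>{m1 + 1..m1 + m2}. rho_I (s k) (t k))"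
    by (rule sum.ub_add_nat) simp
  also have "(\<Sum>k\<in>{m1 + 1..m1 + m2}. rho_I (s k) (t k)) = (\<Sum>k\<in>{1 + m1..m2 + m1}. rho_I (s k) (t k))"
    by (simp only: add.commute)
  also have "\<dots> = (\<Sum>k\<in>{1..m2}. rho_I (s (k + m1)) (t (k + m1)))"
    by (rule sum.shift_bounds_cl_nat_ivl)
  also have "\<dots> = r2"
    unfolding r2 by (rule sum.cong) (auto simp: s_def t_def)
  also have "(\<Sum>k\<in>{1..m1}. rho_I (s k) (t k)) = r1"
    unfolding r1 by (rule sum.cong) (auto simp: s_def t_def)
  finally have sum: "r1 + r2 = (\<Sum>k\<in>{1..m1 + m2}. rho_I (s k) (t k))" by simp
  have "proj_lightlike_geodesic \<Omega> (\<gamma> k) \<and> s k \<in> I_int \<and> t k \<in> I_int" if "k \<in> {1..m1 + m2}" for k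
  proof (cases "k \<le> m1")
    case True
    then show ?thesis using bspec[OF 1(2), of k] that by (simp add: \<gamma>_def s_def t_def)
  next
    case False
    then have "k - m1 \<in> {1..m2}" using that by auto
    then show ?thesis using bspec[OF 2(2)] False by (simp add: \<gamma>_def s_def t_def)
  qed
  moreover note join1 = 1(5)
  have "\<gamma> k (t k) = \<gamma> (k + 1) (s (k + 1))" if "k \<in> {1..<m1 + m2}" for k
  proof -
    consider "k < m1" | "k = m1" | "k > m1" by linarith
    then show ?thesis
    proof cases
      case 1
      then show ?thesis using bspec[OF join1, of k] that
        by (simp add: \<gamma>_def s_def t_def)
    next
      case 2
      then show ?thesis using \<open>\<gamma>1 m1 (t1 m1) = y\<close> \<open>\<gamma>2 1 (s2 1) = y\<close> by (simp add: \<gamma>_def s_def t_def)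
    next
      case 3
      then have "k - m1 \<in> {1..<m2}" using that by auto
      then show ?thesis using bspec[OF 2(5)] 3 by (simp add: \<gamma>_def s_def t_def Suc_diff_le)
    qed
  qed
  moreover have "\<gamma> 1 (s 1) = x" using 1(1,3) by (simp add: \<gamma>_def s_def)
  moreover have "\<gamma> (m1 + m2) (t (m1 + m2)) = z" using 2(1,4) by (simp add: \<gamma>_def t_def)
  moreover have "m1 + m2 \<ge> 1" using 1(1) by simp
  ultimately have "markowitz_chain \<Omega> (m1 + m2) \<gamma> s t x z"
    by (simp add: markowitz_chain_def)
  then show ?thesis
    unfolding sum by (rule markowitz_sumsI)
qed

text \<open>Turns the region below the graph of \<open>Gp\<close> into the epigraph of
  \<open>- Gp\<close>, so that the future time becomes an \<open>epi_tau\<close>.\<close>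

definition reflect :: "'n::finite minkowski \<Rightarrow> 'n minkowski" where
  "reflect x = (- fst x, snd x)"

lemma fst_reflect [simp]: "fst (reflect x) = - fst x" and snd_reflect [simp]: "snd (reflect x) = snd x"
  by (simp_all add: reflect_def)

lemma reflect_reflect [simp]: "reflect (reflect x) = x"
  by (simp add: reflect_def)

lemma cone_le_reflect [simp]: "cone_le (reflect x) (reflect y) \<longleftrightarrow> cone_le y x"
  by (simp add: cone_le_dist dist_commute)

lemma reflect_lray: "reflect (x + lray u s) = reflect x + lray (- u) (- s)"
  by (simp add: reflect_def lray_def)

lemma time_sep_reflect: "time_sep (reflect x) (reflect z) = time_sep x z"
  by (simp add: time_sep_sq_sep sq_sep_def power2_commute)

section \<open>Comparison of the two distances\<close>

locale cone_slab =
  fixes \<Omega> :: "'n::finite minkowski set" and Gm Gp :: "real ^ 'n \<Rightarrow> real" and L :: real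
  assumes op: "open \<Omega>" and conn: "connected \<Omega>"
    and lip_lower: "L-lipschitz_on UNIV Gm" and lip_upper: "L-lipschitz_on UNIV Gp" and L1: "L < 1"
    and past_iff: "y \<in> \<Omega> \<Longrightarrow> cone_le z y \<Longrightarrow> z \<in> \<Omega> \<longleftrightarrow> Gm (snd z) < fst z"
    and future_iff: "y \<in> \<Omega> \<Longrightarrow> cone_le y z \<Longrightarrow> z \<in> \<Omega> \<longleftrightarrow> fst z < Gp (snd z)"
begin

sublocale lo: lipschitz_epigraph Gm L
  by unfold_locales (rule lip_lower, rule L1)

sublocale hi: lipschitz_epigraph "\<lambda>p. - Gp p" L
  by unfold_locales (simp add: lip_upper, rule L1)

lemma above_lower: "x \<in> \<Omega> \<Longrightarrow> Gm (snd x) < fst x"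
  using past_iff[of x x] by simp

lemma below_upper: "x \<in> \<Omega> \<Longrightarrow> - Gp (snd (reflect x)) < fst (reflect x)"
  using future_iff[of x x] by simp

lemma between: "x \<in> \<Omega> \<Longrightarrow> y \<in> \<Omega> \<Longrightarrow> cone_le x z \<Longrightarrow> cone_le z y \<Longrightarrow> z \<in> \<Omega>"
  using past_iff lo.above_up above_lower by blast

lemma tau_past_eq:
  assumes "x \<in> \<Omega>"
  shows "tau_past \<Omega> x = epi_tau Gm x"
proof -
  have "\<Omega> \<inter> J_past x = epi_past Gm x"
    using past_iff[OF assms] by (auto simp: J_past_def epi_past_def causal_le_mink_iff)
  then show ?thesis by (simp add: tau_past_def epi_tau_def)
qed

lemma tau_future_eq:
  assumes "x \<in> \<Omega>"
  shows "tau_future \<Omega> x = epi_tau (\<lambda>p. - Gp p) (reflect x)"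
proof -
  have iff: "reflect z \<in> epi_past (\<lambda>p. - Gp p) (reflect x) \<longleftrightarrow> z \<in> \<Omega> \<inter> J_future x" for z
    using future_iff[OF assms, of z] by (auto simp: J_future_def epi_past_def causal_le_mink_iff)
  have "epi_past (\<lambda>p. - Gp p) (reflect x) = reflect ` (\<Omega> \<inter> J_future x)"
  proof (intro subset_antisym subsetI)
    fix w assume "w \<in> epi_past (\<lambda>p. - Gp p) (reflect x)"
    then show "w \<in> reflect ` (\<Omega> \<inter> J_future x)"
      using iff[of "reflect w"] by (metis image_eqI reflect_reflect)
  qed (use iff in auto)
  then show ?thesis
    by (simp add: tau_future_def epi_tau_def image_image time_sep_reflect)
qed

section \<open>From null chains to Markowitz chains\<close>

definition T :: "'n minkowski \<Rightarrow> real" where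
  "T z = ln (tau_past \<Omega> z / tau_future \<Omega> z)"

lemma T_eq:
  assumes "x \<in> \<Omega>"
  shows "T x = ln (epi_tau Gm x) - ln (epi_tau (\<lambda>p. - Gp p) (reflect x))"
  using lo.epi_tau_pos[OF above_lower[OF assms]] hi.epi_tau_pos[OF below_upper[OF assms]]
  by (simp add: T_def tau_past_eq[OF assms] tau_future_eq[OF assms] ln_div)

text \<open>The geodesic is the maximal null segment of \<open>\<Omega>\<close> through
  \<open>x\<close>, parametrised affinely. Its distance splits as
  \<open>ln (1 + s / a) + ln (1 + s / (b - s))\<close>, and \<open>epi_tau_null_growth\<close>
  bounds the first term by the past time and the second by the future time.\<close>

lemma null_segment_geodesic:
  assumes x: "x \<in> \<Omega>" and y: "x + lray u s \<in> \<Omega>" and u: "norm u = 1" and s: "0 \<le> s"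
  obtains \<gamma> p q where "proj_lightlike_geodesic \<Omega> \<gamma>" "p \<in> I_int" "q \<in> I_int" "\<gamma> p = x" "\<gamma> q = x + lray u s"
    "rho_I p q \<le> 2 * (T (x + lray u s) - T x)"
proof -
  define y where "y = x + lray u s"
  have yO: "y \<in> \<Omega>" using y by (simp add: y_def)
  have u': "norm (- u) = 1" using u by simp
  obtain a where a: "0 < a" "\<not> Gm (snd (x + lray u (- a))) < fst (x + lray u (- a))"
    "\<And>r. - a < r \<Longrightarrow> Gm (snd (x + lray u r)) < fst (x + lray u r)"
    using lo.null_exit[OF above_lower[OF x] u] by metis
  obtain b where b: "0 < b"
    "\<not> - Gp (snd (reflect x + lray (- u) (- b))) < fst (reflect x + lray (- u) (- b))"
    "\<And>r. - b < r \<Longrightarrow> - Gp (snd (reflect x + lray (- u) r)) < fst (reflect x + lray (- u) r)"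
    using hi.null_exit[OF below_upper[OF x] u'] by metis
  have below: "fst (x + lray u r) < Gp (snd (x + lray u r))" if "r < b" for r
    using b(3)[of "- r"] that by simp
  have seg: "x + lray u r \<in> \<Omega>" if "- a < r" "r < b" for r
  proof (cases "r \<le> 0")
    case True
    then show ?thesis
      using past_iff[OF x, of "x + lray u r"] cone_le_lray[OF u True, of x] a(3)[OF that(1)] by simp
  next
    case False
    then show ?thesis
      using future_iff[OF x, of "x + lray u r"] cone_le_lray[OF u, of 0 r x] below[OF that(2)] by simp
  qed
  \<comment> \<open>Otherwise the exit point \<open>x + lray u b\<close> would lie causally between
    \<open>x\<close> and \<open>y\<close>, hence in \<open>\<Omega>\<close>.\<close>
  have sb: "s < b"
  proof (rule ccontr)
    assume "\<not> s < b"
    then have "cone_le (x + lray u b) y" "cone_le x (x + lray u b)"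
      using cone_le_lray[OF u, of b s x] cone_le_lray[OF u, of 0 b x] b(1) by (simp_all add: y_def)
    then have "x + lray u b \<in> \<Omega>" using between[OF x yO] by blast
    then show False using below_upper[of "x + lray u b"] b(2) unfolding reflect_lray by blast
  qed
  \<comment> \<open>\<open>h\<close> maps -1 to \<open>- a\<close> and 1 to \<open>b\<close>;
    \<open>p\<close> and \<open>q\<close> are the preimages of 0 and \<open>s\<close>.\<close>
  define h where "h r = (b - a) / 2 + r * ((a + b) / 2)" for r
  define p where "p = (a - b) / (a + b)"
  define q where "q = (2 * s - b + a) / (a + b)"
  have ab: "0 < a + b" using a(1) b(1) by simp
  have pI: "1 + p = 2 * a / (a + b)" "1 - p = 2 * b / (a + b)"
    using ab by (simp_all add: p_def field_simps)
  have qI: "1 + q = 2 * (s + a) / (a + b)" "1 - q = 2 * (b - s) / (a + b)"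
    using ab by (simp_all add: q_def field_simps)
  have "0 < 1 + p" "0 < 1 - p" "0 < 1 + q" "0 < 1 - q"
    unfolding pI qI using a(1) b(1) s sb by simp_all
  then have I: "p \<in> I_int" "q \<in> I_int" by simp_all
  have h: "h p = 0" "h q = s" using ab by (simp_all add: h_def p_def q_def field_simps)
  have "proj_lightlike_geodesic \<Omega> (\<lambda>r. x + lray u (h r))"
    unfolding proj_lightlike_geodesic_def
  proof (intro exI conjI ballI)
    show "lightlike mink (lray u 1)"
      using u by (simp add: lightlike_def mink_self lray_def zero_prod_def)
    show "homography_on_I h"
      unfolding homography_on_I_def h_def
      by (rule exI[of _ "(a + b) / 2"], rule exI[of _ "(b - a) / 2"], rule exI[of _ 0], rule exI[of _ 1])
        (use ab in \<open>simp add: algebra_simps\<close>)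
    fix r assume r: "r \<in> I_int"
    show "x + lray u (h r) = x + h r *\<^sub>R lray u 1" by (simp add: lray_def)
    have "h r + a = (1 + r) * ((a + b) / 2)" "b - h r = (1 - r) * ((a + b) / 2)"
      by (simp_all add: h_def field_simps)
    moreover have "0 < (1 + r) * ((a + b) / 2)" "0 < (1 - r) * ((a + b) / 2)"
      using ab r by simp_all
    ultimately show "x + lray u (h r) \<in> \<Omega>" by (intro seg) linarith+
  qed
  moreover have "rho_I p q \<le> 2 * (T y - T x)"
  proof -
    have "p \<le> q" using ab s by (simp add: p_def q_def divide_right_mono)
    then have "rho_I p q = (ln (1 + q) - ln (1 + p)) + (ln (1 - p) - ln (1 - q))"
      using I cross_log_less[of "-1" p q 1] by (simp add: rho_I_cross_log add.commute)
    also have "\<dots> = ln ((1 + q) / (1 + p)) + ln ((1 - p) / (1 - q))"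
      using I by (simp add: ln_div)
    finally have rho1: "rho_I p q = ln ((1 + q) / (1 + p)) + ln ((1 - p) / (1 - q))" .
    have cancel: "(2 * v / (a + b)) / (2 * w / (a + b)) = v / w" for v w using ab by simp
    have "(1 + q) / (1 + p) = (s + a) / a" unfolding pI qI by (rule cancel)
    also have "\<dots> = 1 + s / a" using a(1) by (simp add: add_divide_distrib)
    finally have 1: "(1 + q) / (1 + p) = 1 + s / a" .
    have "(1 - p) / (1 - q) = b / (b - s)" unfolding pI qI by (rule cancel)
    also have "\<dots> = 1 + s / (b - s)" using sb by (simp add: divide_simps)
    finally have rho: "rho_I p q = ln (1 + s / a) + ln (1 + s / (b - s))"
      unfolding rho1 1 by (rule arg_cong)
    have ineq: "ln (1 + c) \<le> 2 * (ln t' - ln t)" if "t\<^sup>2 * (1 + c) \<le> t'\<^sup>2" "0 \<le> c" "0 < t" "0 < t'" for c t t' :: real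
    proof -
      have "ln (t\<^sup>2 * (1 + c)) \<le> ln (t'\<^sup>2)" using that by (subst ln_le_cancel_iff) auto
      then show ?thesis using that by (simp add: ln_mult ln_realpow)
    qed
    have "ln (1 + s / a) \<le> 2 * (ln (epi_tau Gm y) - ln (epi_tau Gm x))"
      using lo.epi_tau_null_growth[OF above_lower[OF x] u s a(1,2)] a(1) s
        lo.epi_tau_pos[OF above_lower[OF x]] lo.epi_tau_pos[OF above_lower[OF yO]]
      by (intro ineq) (simp_all add: y_def)
    moreover have "ln (1 + s / (b - s)) \<le>
      2 * (ln (epi_tau (\<lambda>p. - Gp p) (reflect x)) - ln (epi_tau (\<lambda>p. - Gp p) (reflect y)))"
    proof -
      \<comment> \<open>After reflection the ray runs from \<open>y\<close> to \<open>x\<close>, so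
        the growth estimate starts at \<open>y\<close>, whose distance to the future exit point is
        \<open>b - s\<close>.\<close>
      have 1: "reflect y + lray (- u) s = reflect x"
        by (simp add: y_def reflect_lray add.assoc flip: lray_add)
      have 2: "reflect y + lray (- u) (- (b - s)) = reflect x + lray (- u) (- b)"
        by (simp add: y_def reflect_lray add.assoc flip: lray_add)
      have "0 < b - s" using sb by simp
      from hi.epi_tau_null_growth[OF below_upper[OF yO] u' s this, unfolded 1 2, OF b(2)] show ?thesis
        using sb s hi.epi_tau_pos[OF below_upper[OF x]] hi.epi_tau_pos[OF below_upper[OF yO]]
        by (intro ineq) simp_all
    qed
    ultimately show ?thesis unfolding rho T_eq[OF x] T_eq[OF yO] by argo
  qed
  ultimately show ?thesis using that[of "\<lambda>r. x + lray u (h r)" p q] I h by (simp add: y_def)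
qed

text \<open>Falls out of \<open>rho_I\<close> being nonnegative; it is what allows the absolute
  value in \<open>T_null_segment_le\<close>.\<close>

lemma T_mono_null:
  assumes "x \<in> \<Omega>" "x + lray u s \<in> \<Omega>" "norm u = 1" "0 \<le> s"
  shows "T x \<le> T (x + lray u s)"
proof -
  obtain p q where "rho_I p q \<le> 2 * (T (x + lray u s) - T x)"
    using null_segment_geodesic[OF assms] by metis
  moreover have "0 \<le> rho_I p q" by (simp add: rho_I_def)
  ultimately show ?thesis by simp
qed

lemma null_segment_markowitz:
  assumes "x \<in> \<Omega>" "x + lray u s \<in> \<Omega>" "norm u = 1" "0 \<le> s"
  shows "\<exists>r \<in> markowitz_sums \<Omega> x (x + lray u s) \<inter> markowitz_sums \<Omega> (x + lray u s) x.
    r \<le> 2 * (T (x + lray u s) - T x)"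
proof -
  obtain \<gamma> p q where g: "proj_lightlike_geodesic \<Omega> \<gamma>" and pq: "p \<in> I_int" "q \<in> I_int"
    and eq: "\<gamma> p = x" "\<gamma> q = x + lray u s"
    and le: "rho_I p q \<le> 2 * (T (x + lray u s) - T x)"
    by (rule null_segment_geodesic[OF assms])
  have "rho_I q p = rho_I p q" unfolding rho_I_cross_log by (rule cross_log_commute)
  then have "rho_I p q \<in> markowitz_sums \<Omega> x (x + lray u s) \<inter> markowitz_sums \<Omega> (x + lray u s) x"
    using markowitz_sums_single[OF g pq] markowitz_sums_single[OF g pq(2,1)] unfolding eq by simp
  then show ?thesis using le by blast
qed

text \<open>A causal vector is the sum of two null vectors with opposite spatial directions
  \<open>u\<close> and \<open>- u\<close>: their lengths \<open>b\<close> and \<open>c\<close> solve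
  \<open>b + c = \<alpha>\<close> and \<open>b - c = norm w\<close>. The corner \<open>m\<close>
  lies between \<open>x\<close> and \<open>y\<close>, and the differences of \<open>T\<close>
  telescope.\<close>

lemma causal_markowitz:
  assumes x: "x \<in> \<Omega>" and y: "y \<in> \<Omega>" and le: "cone_le x y"
  shows "\<exists>r \<in> markowitz_sums \<Omega> x y \<inter> markowitz_sums \<Omega> y x. r \<le> 2 * (T y - T x)"
proof -
  define w where "w = snd y - snd x"
  define \<alpha> where "\<alpha> = fst y - fst x"
  obtain u :: "real ^ 'n" where u: "norm u = 1" "w = norm w *\<^sub>R u"
  proof (cases "w = 0")
    case True
    obtain u :: "real ^ 'n" where "norm u = 1" using vector_choose_size[of 1] by auto
    then show ?thesis using that True by simp
  next
    case False
    then show ?thesis using that[of "sgn w"] by (simp add: norm_sgn sgn_div_norm)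
  qed
  have w: "norm w \<le> \<alpha>" using le by (simp add: cone_le_def w_def \<alpha>_def)
  define b where "b = (\<alpha> + norm w) / 2"
  define c where "c = (\<alpha> - norm w) / 2"
  have "0 \<le> \<alpha>" using w norm_ge_zero[of w] by linarith
  then have bc: "0 \<le> c" "0 \<le> b" using w by (simp_all add: b_def c_def)
  define m where "m = x + lray u b"
  have "b *\<^sub>R u + c *\<^sub>R (- u) = (b - c) *\<^sub>R u" by (simp add: scaleR_diff_left)
  also have "b - c = norm w" by (simp add: b_def c_def field_simps)
  finally have "b *\<^sub>R u + c *\<^sub>R (- u) = w" using u(2) by simp
  moreover have "b + c = \<alpha>" by (simp add: b_def c_def field_simps)
  ultimately have ym: "y = m + lray (- u) c"
    by (intro prod_eqI) (simp_all add: m_def w_def \<alpha>_def algebra_simps)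
  have u': "norm (- u) = 1" using u by simp
  have "cone_le x m" "cone_le m y"
    unfolding ym m_def using cone_le_lray[OF u(1) bc(2), of x] cone_le_lray[OF u' bc(1), of m]
    by (simp_all add: m_def)
  then have m: "m \<in> \<Omega>" by (rule between[OF x y])
  obtain r1 where r1: "r1 \<in> markowitz_sums \<Omega> x m" "r1 \<in> markowitz_sums \<Omega> m x" "r1 \<le> 2 * (T m - T x)"
    using null_segment_markowitz[OF x _ u(1) bc(2)] m unfolding m_def by blast
  obtain r2 where r2: "r2 \<in> markowitz_sums \<Omega> m y" "r2 \<in> markowitz_sums \<Omega> y m" "r2 \<le> 2 * (T y - T m)"
    using null_segment_markowitz[OF m _ u' bc(1)] y unfolding ym by blast
  have "r1 + r2 \<in> markowitz_sums \<Omega> x y" by (rule markowitz_sums_append[OF r1(1) r2(1)])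
  moreover have "r1 + r2 \<in> markowitz_sums \<Omega> y x"
    using markowitz_sums_append[OF r2(2) r1(2)] by (simp add: add.commute)
  ultimately show ?thesis using r1(3) r2(3) by (intro bexI[of _ "r1 + r2"]) auto
qed

lemma causally_related_markowitz:
  assumes "x \<in> \<Omega>" "y \<in> \<Omega>" "causally_related mink x y"
  shows "\<exists>r \<in> markowitz_sums \<Omega> x y. r \<le> 2 * \<bar>T y - T x\<bar>"
proof -
  have "cone_le x y \<or> cone_le y x"
    using assms(3) by (simp add: causally_related_def causal_le_mink_iff)
  then obtain r where r: "r \<in> markowitz_sums \<Omega> x y" "r \<le> 2 * (T y - T x) \<or> r \<le> 2 * (T x - T y)"
    using causal_markowitz assms(1,2) by (metis IntD1 IntD2)
  then have "r \<le> 2 * \<bar>T y - T x\<bar>" by (auto simp: abs_if)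
  with r(1) show ?thesis by blast
qed

lemma null_chain_markowitz:
  assumes "null_chain \<Omega> m z x y"
  shows "\<exists>r \<in> markowitz_sums \<Omega> x y. r \<le> 2 * (\<Sum>k\<in>{1..<m}. \<bar>T (z (k + 1)) - T (z k)\<bar>)"
proof -
  have m: "1 \<le> m" and xy: "z 1 = x" "z m = y" and O: "\<forall>k\<in>{1..m}. z k \<in> \<Omega>"
    and rel: "\<forall>k\<in>{1..<m}. causally_related mink (z k) (z (k + 1))"
    using assms by (simp_all add: null_chain_def)
  have "n \<le> m \<longrightarrow> (\<exists>r \<in> markowitz_sums \<Omega> (z 1) (z n). r \<le> 2 * (\<Sum>k\<in>{1..<n}. \<bar>T (z (k + 1)) - T (z k)\<bar>))"
    if "1 \<le> n" for n
    using that
  proof (induction n rule: dec_induct)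
    case base
    \<comment> \<open>A Markowitz chain has at least one geodesic, so the empty null sum is matched
      by a chain from \<open>z 1\<close> to itself of total length at most 0.\<close>
    have "z 1 \<in> \<Omega>" using O m by simp
    then show ?case using causal_markowitz[of "z 1" "z 1"] by fastforce
  next
    case (step n)
    show ?case
    proof
      assume n: "Suc n \<le> m"
      then obtain r where r: "r \<in> markowitz_sums \<Omega> (z 1) (z n)"
        "r \<le> 2 * (\<Sum>k\<in>{1..<n}. \<bar>T (z (k + 1)) - T (z k)\<bar>)"
        using step.IH by auto
      have "z n \<in> \<Omega>" "z (n + 1) \<in> \<Omega>" "causally_related mink (z n) (z (n + 1))"
        using O rel n step.hyps by simp_all
      then obtain r' where r': "r' \<in> markowitz_sums \<Omega> (z n) (z (n + 1))" "r' \<le> 2 * \<bar>T (z (n + 1)) - T (z n)\<bar>"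
        using causally_related_markowitz by blast
      have "r + r' \<in> markowitz_sums \<Omega> (z 1) (z (Suc n))"
        using markowitz_sums_append[OF r(1) r'(1)] by simp
      moreover have "r + r' \<le> 2 * (\<Sum>k\<in>{1..<Suc n}. \<bar>T (z (k + 1)) - T (z k)\<bar>)"
        using r(2) r'(2) step.hyps by simp
      ultimately show "\<exists>r \<in> markowitz_sums \<Omega> (z 1) (z (Suc n)).
          r \<le> 2 * (\<Sum>k\<in>{1..<Suc n}. \<bar>T (z (k + 1)) - T (z k)\<bar>)" by blast
    qed
  qed
  from this[OF m] show ?thesis using xy by simp
qed

text \<open>\<open>Inf\<close> of an empty set of reals has no meaning here, so a chain has to be
  produced. Points near \<open>c\<close> are joined to \<open>c\<close> through a common point of
  their futures, and connectedness does the rest.\<close>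

lemma null_sums_nonempty:
  assumes x: "x \<in> \<Omega>" and y: "y \<in> \<Omega>"
  shows "null_sums \<Omega> f x y \<noteq> {}"
proof -
  define R where "R = {(v, w). v \<in> \<Omega> \<and> w \<in> \<Omega> \<and> causally_related mink v w}"
  have symR: "sym R" by (auto simp: R_def sym_def causally_related_def)
  have "(x, y) \<in> R\<^sup>*"
  proof (rule connected_equivalence_relation[OF conn x y])
    fix c assume c: "c \<in> \<Omega>"
    then obtain e where e: "0 < e" "\<And>w. dist w c < e \<Longrightarrow> w \<in> \<Omega>"
      using op unfolding open_dist by blast
    \<comment> \<open>At height \<open>e / 2\<close> above \<open>c\<close>, \<open>p\<close> is
      still more than \<open>e / 4\<close> later than every point of the ball of radius
      \<open>e / 4\<close>, hence in the causal future of all of them.\<close>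
    define p where "p = (fst c + e / 2, snd c)"
    have p: "p \<in> \<Omega>" using e(1) by (intro e(2)) (simp add: p_def dist_prod_def dist_real_def)
    have "(c, w) \<in> R\<^sup>*" if w: "w \<in> ball c (e / 4)" for w
    proof -
      have d: "dist w c < e / 4" using w by (simp add: dist_commute)
      have wO: "w \<in> \<Omega>" using d e(1) by (intro e(2)) simp
      have "dist (snd w) (snd c) < e / 4" "dist (fst w) (fst c) < e / 4"
        using d dist_snd_le[of w c] dist_fst_le[of w c] by linarith+
      then have "cone_le w p" unfolding cone_le_dist p_def dist_real_def fst_conv snd_conv by linarith
      moreover have "cone_le c p" using e(1) by (simp add: cone_le_dist p_def)
      ultimately have "(c, p) \<in> R" "(p, w) \<in> R"
        using c p wO by (simp_all add: R_def causally_related_def causal_le_mink_iff)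
      then show ?thesis by (meson converse_rtrancl_into_rtrancl r_into_rtrancl)
    qed
    moreover have "ball c (e / 4) \<subseteq> \<Omega>" using e by (auto simp: dist_commute)
    ultimately show "\<exists>S. openin (top_of_set \<Omega>) S \<and> c \<in> S \<and> (\<forall>w\<in>S. (c, w) \<in> R\<^sup>*)"
      using e(1) by (intro exI[of _ "ball c (e / 4)"]) (auto intro: open_subset)
  qed (use symR in \<open>auto dest: sym_rtrancl symD\<close>)
  then have "\<exists>m z. null_chain \<Omega> m z x y"
  proof (induction rule: rtrancl_induct)
    case base
    have "null_chain \<Omega> 1 (\<lambda>_. x) x x" using x by (simp add: null_chain_def)
    then show ?case by blast
  next
    case (step v w)
    then obtain m z where c: "null_chain \<Omega> m z x v" by blast
    have "null_chain \<Omega> (m + 1) (z(m + 1 := w)) x w"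
      using c step.hyps(2) by (auto simp: null_chain_def R_def le_Suc_eq less_Suc_eq)
    then show ?case by blast
  qed
  then show ?thesis using null_sumsI by blast
qed

lemma markowitz_le_null_distance:
  assumes "x \<in> \<Omega>" "y \<in> \<Omega>"
  shows "markowitz \<Omega> x y \<le> 2 * null_distance \<Omega> T x y"
proof -
  have bdd: "bdd_below (markowitz_sums \<Omega> x y)"
    using markowitz_sums_nonneg by (rule bdd_belowI)
  have "markowitz \<Omega> x y / 2 \<le> null_distance \<Omega> T x y"
    unfolding null_distance_eq
  proof (rule cInf_greatest[OF null_sums_nonempty[OF assms]])
    fix S assume "S \<in> null_sums \<Omega> T x y"
    then obtain m z where "null_chain \<Omega> m z x y" "S = (\<Sum>k\<in>{1..<m}. \<bar>T (z (k + 1)) - T (z k)\<bar>)"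
      unfolding null_sums_def by blast
    then obtain r where "r \<in> markowitz_sums \<Omega> x y" "r \<le> 2 * S"
      using null_chain_markowitz by blast
    then show "markowitz \<Omega> x y / 2 \<le> S"
      using cInf_lower[OF _ bdd, of r] by (simp add: markowitz_eq)
  qed
  then show ?thesis by simp
qed

section \<open>From Markowitz chains to null chains\<close>

lemma T_null_segment_le:
  assumes ends: "x + lray u \<alpha> \<in> \<Omega>" "x + lray u \<beta> \<in> \<Omega>" and u: "norm u = 1"
    and order: "\<alpha> < s" "s \<le> t" "t < \<beta>"
  shows "\<bar>T (x + lray u t) - T (x + lray u s)\<bar> \<le> 2 * lo.M * cross_log \<alpha> \<beta> s t"
proof -
  have seg: "x + lray u r \<in> \<Omega>" if "\<alpha> < r" "r < \<beta>" for r
    using between[OF ends] cone_le_lray[OF u, of \<alpha> r x] cone_le_lray[OF u, of r \<beta> x] that by simp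
  have s: "x + lray u s \<in> \<Omega>" and t: "x + lray u t \<in> \<Omega>" using seg order by auto
  \<comment> \<open>The past time is charged to the end \<alpha> and the future time to the end
    \<beta>. The ends only need to be points of \<open>\<Omega>\<close>, not exit points.\<close>
  have "ln (epi_tau Gm (x + lray u t)) - ln (epi_tau Gm (x + lray u s)) \<le> 2 * lo.M * (ln (t - \<alpha>) - ln (s - \<alpha>))"
    using lo.ln_epi_tau_null_le[OF u above_lower[OF ends(1)], of "s - \<alpha>" "t - \<alpha>"] order
    by (simp add: add.assoc flip: lray_add)
  moreover have "ln (epi_tau (\<lambda>p. - Gp p) (reflect (x + lray u s))) - ln (epi_tau (\<lambda>p. - Gp p) (reflect (x + lray u t)))
      \<le> 2 * lo.M * (ln (\<beta> - s) - ln (\<beta> - t))"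
    using hi.ln_epi_tau_null_le[OF _ below_upper[OF ends(2)], of "- u" "\<beta> - t" "\<beta> - s"] order u
    by (simp add: reflect_lray add.assoc flip: lray_add)
  ultimately have "T (x + lray u t) - T (x + lray u s) \<le> 2 * lo.M * cross_log \<alpha> \<beta> s t"
    unfolding cross_log_less[OF order] T_eq[OF s] T_eq[OF t] by (simp add: algebra_simps)
  moreover have "T (x + lray u s) \<le> T (x + lray u t)"
    using T_mono_null[OF s, of u "t - s"] t u order by (simp add: add.assoc flip: lray_add)
  ultimately show ?thesis by linarith
qed

lemma T_geodesic_le:
  assumes \<gamma>: "proj_lightlike_geodesic \<Omega> \<gamma>" and st: "s \<in> I_int" "t \<in> I_int"
  shows "\<bar>T (\<gamma> t) - T (\<gamma> s)\<bar> \<le> 2 * lo.M * rho_I s t" and "causally_related mink (\<gamma> s) (\<gamma> t)"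
proof -
  obtain x v h where v: "lightlike mink v" and h: "homography_on_I h"
    and \<gamma>: "\<And>r. r \<in> I_int \<Longrightarrow> \<gamma> r = x + h r *\<^sub>R v \<and> \<gamma> r \<in> \<Omega>"
    using \<gamma> unfolding proj_lightlike_geodesic_def by blast
  have v': "v \<noteq> 0" "(norm (snd v))\<^sup>2 = (fst v)\<^sup>2" using v by (simp_all add: lightlike_def mink_self)
  have fv: "fst v \<noteq> 0"
  proof
    assume "fst v = 0"
    moreover from this have "snd v = 0" using v'(2) by simp
    ultimately have "v = 0" by (intro prod_eqI) simp_all
    then show False using v'(1) by blast
  qed
  \<comment> \<open>\<open>v\<close> may point to the past; its time component, sign included, is
    moved into the homography \<open>k\<close>.\<close>
  define u where "u = snd v /\<^sub>R fst v"
  have "norm (snd v) = \<bar>fst v\<bar>" by (rule power2_eq_imp_eq) (simp_all only: v'(2) power2_abs norm_ge_zero abs_ge_zero)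
  then have u: "norm u = 1" using fv by (simp add: u_def)
  define k where "k r = h r * fst v" for r
  have k: "homography_on_I k" unfolding k_def using h fv by (rule homography_on_I_scale)
  have \<gamma>k: "\<gamma> r = x + lray u (k r)" and \<gamma>\<Omega>: "x + lray u (k r) \<in> \<Omega>" if "r \<in> I_int" for r
  proof -
    have "h r *\<^sub>R v = lray u (k r)"
      using fv by (intro prod_eqI) (simp_all add: u_def k_def)
    then show "\<gamma> r = x + lray u (k r)" "x + lray u (k r) \<in> \<Omega>" using \<gamma>[OF that] by auto
  qed
  show "causally_related mink (\<gamma> s) (\<gamma> t)"
    unfolding causally_related_def causal_le_mink_iff \<gamma>k[OF st(1)] \<gamma>k[OF st(2)]
    using cone_le_lray[OF u, of "k s" "k t" x] cone_le_lray[OF u, of "k t" "k s" x] by argo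
  have sym: "\<bar>T (x + lray u b) - T (x + lray u a)\<bar> \<le> 2 * lo.M * cross_log \<alpha> \<beta> a b"
    if "x + lray u \<alpha> \<in> \<Omega>" "x + lray u \<beta> \<in> \<Omega>" "{a, b} \<subseteq> {\<alpha><..<\<beta>}" for a b \<alpha> \<beta>
  proof (cases "a \<le> b")
    case True
    then show ?thesis using T_null_segment_le[OF that(1,2) u, of a b] that(3) by simp
  next
    case False
    then show ?thesis
      using T_null_segment_le[OF that(1,2) u, of b a] that(3)
      by (simp add: abs_minus_commute cross_log_commute[of \<alpha> \<beta> a b])
  qed
  \<comment> \<open>\<open>k\<close> may have a pole at an end point of \<open>I\<close>, hence the passage to the limit from \<open>{-r..r}\<close>.\<close>
  have bound: "\<bar>T (\<gamma> t) - T (\<gamma> s)\<bar> \<le> 2 * lo.M * cross_log (- r) r s t"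
    if r: "\<bar>s\<bar> < r" "\<bar>t\<bar> < r" "r < 1" for r
  proof -
    have I: "r \<in> I_int" "- r \<in> I_int" using r by auto
    show ?thesis
      using homography_on_I_cross_log(2)[OF k r]
    proof
      assume "{k s, k t} \<subseteq> {k (- r)<..<k r}"
      from sym[OF \<gamma>\<Omega>[OF I(2)] \<gamma>\<Omega>[OF I(1)] this] show ?thesis
        unfolding homography_on_I_cross_log(1)[OF k r] \<gamma>k[OF st(1)] \<gamma>k[OF st(2)] .
    next
      assume "{k s, k t} \<subseteq> {k r<..<k (- r)}"
      from sym[OF \<gamma>\<Omega>[OF I(1)] \<gamma>\<Omega>[OF I(2)] this] show ?thesis
        unfolding cross_log_commute_ends[of "k r"] homography_on_I_cross_log(1)[OF k r]
          \<gamma>k[OF st(1)] \<gamma>k[OF st(2)] .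
    qed
  qed
  show "\<bar>T (\<gamma> t) - T (\<gamma> s)\<bar> \<le> 2 * lo.M * rho_I s t"
  proof (rule tendsto_lowerbound)
    show "((\<lambda>r. 2 * lo.M * cross_log (- r) r s t) \<longlongrightarrow> 2 * lo.M * rho_I s t) (at_left 1)"
      by (intro tendsto_intros cross_log_tendsto st)
    have "max \<bar>s\<bar> \<bar>t\<bar> < 1" using st by auto
    then have "eventually (\<lambda>r. r \<in> {max \<bar>s\<bar> \<bar>t\<bar><..<1}) (at_left 1)"
      by (rule eventually_at_leftI[rotated]) simp
    then show "\<forall>\<^sub>F r in at_left 1. \<bar>T (\<gamma> t) - T (\<gamma> s)\<bar> \<le> 2 * lo.M * cross_log (- r) r s t"
      by (rule eventually_mono) (use bound in auto)
  qed simp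
qed

lemma markowitz_chain_null:
  assumes "markowitz_chain \<Omega> m \<gamma> s t x y"
  shows "\<exists>S \<in> null_sums \<Omega> T x y. S \<le> 2 * lo.M * (\<Sum>k\<in>{1..m}. rho_I (s k) (t k))"
proof -
  have m: "1 \<le> m" and xy: "\<gamma> 1 (s 1) = x" "\<gamma> m (t m) = y"
    using assms by (simp_all add: markowitz_chain_def)
  have g: "proj_lightlike_geodesic \<Omega> (\<gamma> k)" "s k \<in> I_int" "t k \<in> I_int" if "k \<in> {1..m}" for k
    using assms that by (simp_all add: markowitz_chain_def)
  have join: "\<gamma> k (t k) = \<gamma> (k + 1) (s (k + 1))" if "k \<in> {1..<m}" for k
    using assms that by (simp add: markowitz_chain_def)
  \<comment> \<open>The starting points of the \<open>m\<close> geodesics, followed by the end of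
    the last one: a chain of \<open>m + 1\<close> points.\<close>
  define z where "z k = (if k \<le> m then \<gamma> k (s k) else \<gamma> m (t m))" for k
  have z: "z k = \<gamma> k (s k)" "z (k + 1) = \<gamma> k (t k)" if "k \<in> {1..m}" for k
  proof -
    show "z k = \<gamma> k (s k)" using that by (simp add: z_def)
    show "z (k + 1) = \<gamma> k (t k)"
    proof (cases "k = m")
      case False
      then have "k \<in> {1..<m}" using that by auto
      from join[OF this] show ?thesis using \<open>k \<in> {1..<m}\<close> by (simp add: z_def)
    qed (simp add: z_def)
  qed
  have in\<Omega>: "\<gamma> k r \<in> \<Omega>" if "k \<in> {1..m}" "r \<in> I_int" for k r
    using g(1)[OF that(1)] that(2) unfolding proj_lightlike_geodesic_def by blast
  have "null_chain \<Omega> (m + 1) z x y"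
    unfolding null_chain_def
  proof (intro conjI ballI)
    show "z 1 = x" "z (m + 1) = y" using z(1)[of 1] z(2)[of m] m xy by simp_all
    show "z k \<in> \<Omega>" if "k \<in> {1..m + 1}" for k
    proof (cases "k = m + 1")
      case True
      then show ?thesis using z(2)[of m] in\<Omega>[of m "t m"] g(3)[of m] m by simp
    next
      case False
      then have "k \<in> {1..m}" using that by auto
      then show ?thesis using z(1) in\<Omega> g(2) by metis
    qed
    show "causally_related mink (z k) (z (k + 1))" if "k \<in> {1..<m + 1}" for k
    proof -
      have k: "k \<in> {1..m}" using that by auto
      show ?thesis unfolding z[OF k] by (rule T_geodesic_le(2)[OF g[OF k]])
    qed
  qed simp
  from null_sumsI[OF this, of T]
  have "(\<Sum>k\<in>{1..<m + 1}. \<bar>T (z (k + 1)) - T (z k)\<bar>) \<in> null_sums \<Omega> T x y" .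
  moreover have "(\<Sum>k\<in>{1..<m + 1}. \<bar>T (z (k + 1)) - T (z k)\<bar>) \<le> (\<Sum>k\<in>{1..<m + 1}. 2 * lo.M * rho_I (s k) (t k))"
  proof (rule sum_mono)
    fix k assume "k \<in> {1..<m + 1}"
    then have k: "k \<in> {1..m}" by auto
    show "\<bar>T (z (k + 1)) - T (z k)\<bar> \<le> 2 * lo.M * rho_I (s k) (t k)"
      unfolding z[OF k] by (rule T_geodesic_le(1)[OF g[OF k]])
  qed
  moreover have "(\<Sum>k\<in>{1..<m + 1}. 2 * lo.M * rho_I (s k) (t k)) = 2 * lo.M * (\<Sum>k\<in>{1..m}. rho_I (s k) (t k))"
    by (simp add: sum_distrib_left atLeastLessThanSuc_atLeastAtMost)
  ultimately show ?thesis by (metis (no_types, lifting))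
qed

lemma null_distance_le_markowitz:
  assumes "x \<in> \<Omega>" "y \<in> \<Omega>"
  shows "null_distance \<Omega> T x y \<le> 2 * lo.M * markowitz \<Omega> x y"
proof -
  have bdd: "bdd_below (null_sums \<Omega> T x y)"
    using null_sums_nonneg by (rule bdd_belowI)
  have "markowitz_sums \<Omega> x y \<noteq> {}"
    using null_sums_nonempty[OF assms, of T] null_chain_markowitz unfolding null_sums_def by blast
  moreover have "null_distance \<Omega> T x y / (2 * lo.M) \<le> r" if "r \<in> markowitz_sums \<Omega> x y" for r
  proof -
    obtain m \<gamma> s t where "markowitz_chain \<Omega> m \<gamma> s t x y" "r = (\<Sum>k\<in>{1..m}. rho_I (s k) (t k))"
      using \<open>r \<in> markowitz_sums \<Omega> x y\<close> unfolding markowitz_sums_def by blast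
    then obtain S where "S \<in> null_sums \<Omega> T x y" "S \<le> 2 * lo.M * r"
      using markowitz_chain_null by blast
    then have "null_distance \<Omega> T x y \<le> 2 * lo.M * r"
      using cInf_lower[OF _ bdd, of S] by (simp add: null_distance_eq)
    then show ?thesis using lo.M_pos by (simp add: field_simps)
  qed
  ultimately have "null_distance \<Omega> T x y / (2 * lo.M) \<le> markowitz \<Omega> x y"
    unfolding markowitz_eq by (rule cInf_greatest)
  then show ?thesis using lo.M_pos by (simp add: field_simps)
qed

end

section \<open>The constants of the estimate\<close>

lemma c_eps_nonneg:
  assumes "\<epsilon> > 0"
  shows "0 \<le> c_eps \<epsilon>"
proof -
  have "1 < (1 + \<epsilon>)\<^sup>2" using assms by (intro one_less_power) simp_all
  then have "1 \<le> ((1 + \<epsilon>)\<^sup>2 + 1) / ((1 + \<epsilon>)\<^sup>2 - 1)" by (simp add: le_divide_eq)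
  then show ?thesis using assms by (simp add: c_eps_def)
qed

theorem theorem6p12:
  fixes \<epsilon> :: real and \<Omega> :: "'n::finite minkowski set"
  assumes "\<epsilon> > 0"
    and "minkowski_domain \<Omega>"
    and "causally_convex \<Omega>"
    and "\<not> future_complete \<Omega>"
    and "\<not> past_complete \<Omega>"
    and "stably_acausal \<epsilon> (future_causal_boundary \<Omega>)"
    and "stably_acausal \<epsilon> (past_causal_boundary \<Omega>)"
  shows "\<forall>x\<in>\<Omega>. \<forall>y\<in>\<Omega>.
      \<epsilon> / (2 * sqrt (2 + 2 * (1 + \<epsilon>)\<^sup>2)) *
          null_distance \<Omega> (\<lambda>z. ln (tau_past \<Omega> z / tau_future \<Omega> z)) x y - c_eps \<epsilon>
        \<le> markowitz \<Omega> x y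
    \<and> markowitz \<Omega> x y
        \<le> 2 * null_distance \<Omega> (\<lambda>z. ln (tau_past \<Omega> z / tau_future \<Omega> z)) x y"
proof (intro ballI)
  fix x y assume xy: "x \<in> \<Omega>" "y \<in> \<Omega>"
  obtain Gm Gp where G: "(1 / (1 + \<epsilon>))-lipschitz_on UNIV Gm" "(1 / (1 + \<epsilon>))-lipschitz_on UNIV Gp"
    "\<And>y z. y \<in> \<Omega> \<Longrightarrow> cone_le z y \<Longrightarrow> z \<in> \<Omega> \<longleftrightarrow> Gm (snd z) < fst z"
    "\<And>y z. y \<in> \<Omega> \<Longrightarrow> cone_le y z \<Longrightarrow> z \<in> \<Omega> \<longleftrightarrow> fst z < Gp (snd z)"
    by (rule stably_acausal_slab[OF assms], rule that)
  interpret cone_slab \<Omega> Gm Gp "1 / (1 + \<epsilon>)"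
  proof
    show "open \<Omega>" "connected \<Omega>" using assms(2) by (simp_all add: minkowski_domain_def)
    show "1 / (1 + \<epsilon>) < 1" using assms(1) by simp
  qed (fact G)+
  define d where "d = null_distance \<Omega> T x y"
  define q where "q = sqrt (2 + 2 * (1 + \<epsilon>)\<^sup>2)"
  have M: "lo.M = (2 + \<epsilon>) / \<epsilon>" 
  proof -
    have "1 + 1 / (1 + \<epsilon>) = (2 + \<epsilon>) / (1 + \<epsilon>)" "1 - 1 / (1 + \<epsilon>) = \<epsilon> / (1 + \<epsilon>)"
      using assms(1) by (simp_all add: field_simps)
    then show ?thesis using assms(1) by (simp add: lo.M_def)
  qed
  have q: "0 < q" unfolding q_def by (intro real_sqrt_gt_zero add_pos_nonneg) simp_all
  \<comment> \<open>The difference of the two sides is \<open>\<epsilon>\<^sup>2\<close>.\<close>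
  have "(2 + \<epsilon>)\<^sup>2 \<le> 2 + 2 * (1 + \<epsilon>)\<^sup>2" by (simp add: power2_eq_square algebra_simps)
  then have le_q: "2 + \<epsilon> \<le> q" unfolding q_def by (rule real_le_rsqrt)
  obtain r where "r \<in> markowitz_sums \<Omega> x y"
    using null_sums_nonempty[OF xy, of T] null_chain_markowitz unfolding null_sums_def by blast
  then have \<delta>0: "0 \<le> markowitz \<Omega> x y"
    unfolding markowitz_eq by (intro cInf_greatest markowitz_sums_nonneg) blast
  \<comment> \<open>The 2 in \<open>2 * q\<close> cancels the one in \<open>2 * lo.M\<close>,
    leaving the factor \<open>(2 + \<epsilon>) / q \<le> 1\<close>.\<close>
  have "\<epsilon> / (2 * q) * d \<le> \<epsilon> / (2 * q) * (2 * lo.M * markowitz \<Omega> x y)"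
    unfolding d_def using null_distance_le_markowitz[OF xy] assms(1) q by (intro mult_left_mono) simp_all
  also have "\<dots> = (2 + \<epsilon>) / q * markowitz \<Omega> x y"
    using assms(1) q by (simp add: M divide_simps)
  also have "\<dots> \<le> 1 * markowitz \<Omega> x y"
    using le_q q \<delta>0 by (intro mult_right_mono) simp_all
  finally have "\<epsilon> / (2 * q) * d - c_eps \<epsilon> \<le> markowitz \<Omega> x y"
    using c_eps_nonneg[OF assms(1)] by linarith
  then show "\<epsilon> / (2 * sqrt (2 + 2 * (1 + \<epsilon>)\<^sup>2)) *
          null_distance \<Omega> (\<lambda>z. ln (tau_past \<Omega> z / tau_future \<Omega> z)) x y - c_eps \<epsilon>
        \<le> markowitz \<Omega> x y
    \<and> markowitz \<Omega> x y
        \<le> 2 * null_distance \<Omega> (\<lambda>z. ln (tau_past \<Omega> z / tau_future \<Omega> z)) x y"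
    using markowitz_le_null_distance[OF xy] unfolding d_def q_def T_def by blast
qed

end
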